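(* For each $T\in\left\{\left(-\frac35,-\frac13\right),\left(-\frac13,-\frac1{15}\right),\left(-\frac1{15},\frac15\right)\right\}$ we have $\mathcal{A}\left(23,\frac7{15};T\right)=47104$. Consequently, $C_{1/4}$ is a maximal $T$-avoiding spherical $\frac7{15}$-code for these $T$.
   Context: A spherical code is a finite set $C\subset\mathbb{S}^{n-1}$; $I(C)=\{x\cdot y: x,y\in C,\ x\ne y\}$ and $s(C)=\max I(C)$; $C$ is called an $s$-code when $s(C)=s$. For $T\subset[-1,1)$, $C$ is $T$-avoiding if $I(C)\cap T=\varnothing$. $\mathcal{A}(n,s;T)$ is the maximum of $|C|$ over all $T$-avoiding spherical codes $C\subset\mathbb{S}^{n-1}$ with $s(C)\le s$; a $T$-avoiding $s$-code attaining this maximum is called maximal. The code $C_{1/4}$: let $L\subset\mathbb{S}^{23}$ be the set of the $196560$ minimal vectors of the Leech lattice rescaled to unit length. Fix $x\in L$; $C_{1/4}$ is the set of vectors $(y-\frac14x)/\sqrt{1-\frac1{16}}$ with $y\in L$, $x\cdot y=\frac14$, regarded as a subset of the unit sphere $\mathbb{S}^{22}$ of $x^\perp\cong\mathbb{R}^{23}$. It has $47104$ points and inner products $-\frac35,-\frac13,-\frac1{15},\frac15,\frac7{15}$. *)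

theory Defs
  imports "HOL-Analysis.Analysis" "HOL-Library.Extended_Nat"
begin

section \<open>Spherical codes avoiding a set of inner products\<close>

definition spherical_code :: "(real ^ 'n) set \<Rightarrow> bool" where
  "spherical_code C \<longleftrightarrow> finite C \<and> C \<subseteq> sphere 0 1"

definition inner_products :: "(real ^ 'n) set \<Rightarrow> real set" where
  "inner_products C = {x \<bullet> y | x y. x \<in> C \<and> y \<in> C \<and> x \<noteq> y}"

text \<open>Only meaningful if \<open>C\<close> is finite with at least two points.\<close>

definition max_inner_product :: "(real ^ 'n) set \<Rightarrow> real" where
  "max_inner_product C = Max (inner_products C)"

definition avoiding :: "real set \<Rightarrow> (real ^ 'n) set \<Rightarrow> bool" where
  "avoiding T C \<longleftrightarrow> inner_products C \<inter> T = {}"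

definition is_s_code :: "real \<Rightarrow> (real ^ 'n) set \<Rightarrow> bool" where
  "is_s_code s C \<longleftrightarrow>
     spherical_code C \<and> inner_products C \<noteq> {} \<and> max_inner_product C = s"

text \<open>
  \<open>max_avoiding TYPE('n) s T\<close> is \<open>\<A>(n, s; T)\<close> with \<open>n = CARD('n)\<close>. Codes with at most one
  point satisfy the bound on inner products vacuously. The supremum is taken in \<^typ>\<open>enat\<close>, so
  that a finite value is a genuine, attained maximum.
\<close>

definition max_avoiding :: "'n::finite itself \<Rightarrow> real \<Rightarrow> real set \<Rightarrow> enat" where
  "max_avoiding _ s T =
     (SUP C \<in> {C :: (real ^ 'n) set. spherical_code C \<and> avoiding T C \<and>
                 (inner_products C \<noteq> {} \<longrightarrow> max_inner_product C \<le> s)}. enat (card C))"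

definition maximal_avoiding_code :: "real \<Rightarrow> real set \<Rightarrow> (real ^ 'n::finite) set \<Rightarrow> bool" where
  "maximal_avoiding_code s T C \<longleftrightarrow>
     is_s_code s C \<and> avoiding T C \<and> enat (card C) = max_avoiding TYPE('n) s T"


section \<open>The Leech lattice and the code \<open>C\<^sub>1\<^sub>/\<^sub>4\<close>\<close>

text \<open>
  The 24 coordinates are indexed by the projective line over the field with 23 elements: the
  numeral type \<^typ>\<open>23\<close> is the ring of integers modulo 23, and \<^term>\<open>None\<close> is the point at
  infinity. The extended binary Golay code is realised as the extended quadratic residue code of
  length 24; binary words are identified with their supports, so that addition is symmetric
  difference. It is spanned by the whole projective line and the 23 translates of the set
  consisting of infinity and the quadratic non-residues.
\<close>

definition golay_gen :: "23 \<Rightarrow> 23 option set" where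
  "golay_gen a = insert None {Some (n + a) | n. \<nexists>t. n = t * t}"

inductive_set golay_code :: "23 option set set" where
  zero: "{} \<in> golay_code"
| add_all: "c \<in> golay_code \<Longrightarrow> sym_diff c UNIV \<in> golay_code"
| add_gen: "c \<in> golay_code \<Longrightarrow> sym_diff c (golay_gen a) \<in> golay_code"

text \<open>The standard coordinates of the Leech lattice, with minimal norm 2 (squared norm 4).\<close>

definition leech_lattice :: "(real ^ 23 option) set" where
  "leech_lattice =
     {(1 / sqrt 8) *\<^sub>R (\<chi> i. of_int (a i)) | a :: 23 option \<Rightarrow> int.
        \<exists>m. (\<forall>i. a i mod 2 = m mod 2) \<and> (\<Sum>i\<in>UNIV. a i) mod 8 = (4 * m) mod 8 \<and>
            (\<forall>k. {i. a i mod 4 = k mod 4} \<in> golay_code)}"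

definition minimal_vectors :: "(real ^ 'n) set \<Rightarrow> (real ^ 'n) set" where
  "minimal_vectors \<Lambda> = {v \<in> \<Lambda>. v \<noteq> 0 \<and> (\<forall>w \<in> \<Lambda>. w \<noteq> 0 \<longrightarrow> norm v \<le> norm w)}"

definition leech_code :: "(real ^ 23 option) set" where
  "leech_code = (\<lambda>v. v /\<^sub>R norm v) ` minimal_vectors leech_lattice"

definition C_quarter :: "real ^ 23 option \<Rightarrow> (real ^ 23 option) set" where
  "C_quarter x = {(y - (1/4) *\<^sub>R x) /\<^sub>R sqrt (1 - 1/16) | y. y \<in> leech_code \<and> x \<bullet> y = 1/4}"

text \<open>
  A linear isometry of \<open>\<real>\<^sup>n\<close> onto the orthogonal complement of \<open>x\<close>, by which subsets of the latter
  are regarded as subsets of \<open>\<real>\<^sup>n\<close>.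
\<close>

definition identifies_complement :: "(real ^ 'n \<Rightarrow> real ^ 'm) \<Rightarrow> real ^ 'm \<Rightarrow> bool" where
  "identifies_complement U x \<longleftrightarrow>
     linear U \<and> (\<forall>v. norm (U v) = norm v) \<and> range U = {w. x \<bullet> w = 0}"

lemma ex_identifies_complement:
  fixes x :: "real ^ 'm"
  assumes "x \<noteq> 0" and "CARD('m) = Suc CARD('n)"
  shows "\<exists>U :: real ^ 'n \<Rightarrow> real ^ 'm. identifies_complement U x"
proof -
  have "dim (UNIV :: (real ^ 'n) set) = dim {w. x \<bullet> w = 0}"
    using assms by (simp add: dim_hyperplane)
  then obtain U :: "real ^ 'n \<Rightarrow> real ^ 'm" where
    "linear U" "U ` UNIV = {w. x \<bullet> w = 0}" "\<And>v. norm (U v) = norm v"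
    using isometries_subspaces[of "UNIV :: (real ^ 'n) set" "{w. x \<bullet> w = 0}"]
    by (metis UNIV_I subspace_UNIV subspace_hyperplane)
  then show ?thesis
    unfolding identifies_complement_def by blast
qed

end

theory Submission imports Defs begin

text \<open>
  The upper bound is the linear programming bound in dimension 23. For each of the three intervals
  \<open>T\<close>, take the polynomial of degree 7 with a simple root at \<open>7/15\<close>, simple roots at the end points
  of \<open>T\<close> and double roots at the remaining two of \<open>-3/5, -1/3, -1/15, 1/5\<close>: it is nonpositive on the
  admissible inner products, its Gegenbauer coefficients are positive, and its value at 1 is \<open>47104\<close>
  times its constant coefficient. Positive definiteness of the Gegenbauer kernels comes from the
  Fischer inner product on polynomials, for which multiplication by \<open>|z|\<^sup>2\<close> is adjoint to the
  Laplacian.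

  For the lower bound, transitivity of the Conway group is not needed. The \<open>196560\<close> short vectors
  attain the linear programming bound for the inner products \<open>\<plusminus>1, \<plusminus>1/2, \<plusminus>1/4, 0\<close> in dimension 24,
  which forces every one of them to have the same number \<open>47104\<close> of neighbours at inner product
  \<open>1/4\<close>. The inner product \<open>7/15\<close> occurs in the derived code since otherwise a cubic polynomial
  would bound its size by 267.
\<close>

section \<open>Positive definiteness of Gegenbauer polynomials\<close>

text \<open>Equality in the linear programming bound forces the polynomial to vanish at all five
  inner products of C_1/4. Without a gap, the four inner products below 7/15 would have to be zeros
  of even order, which gives degree 9. Avoiding \<open>T\<close> allows the polynomial to be
  positive between the two inner products that border \<open>T\<close>, so these become simple zeros
  and the degree drops to 7.

  On the lattice side every count is only a lower bound (4096 words, 759 octads, 196560 short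
  vectors). The bound in dimension 24 makes the last one exact, so neither the dimension of the
  Golay code nor the list of short vectors has to be determined from above.\<close>

text \<open>
  A polynomial is represented by its coefficient function on exponent vectors, and homogeneity is
  imposed only by restricting to the exponent vectors of one degree.
\<close>

definition exponents :: "nat \<Rightarrow> ('n::finite \<Rightarrow> nat) set" where
  "exponents k = {e. sum e UNIV = k}"

text \<open>For parts of degree \<open>k\<close> this is p(D) q at 0: monomials are orthogonal and
  the factorial weight is their squared norm. Positivity is thus a sum of squares, without
  integration over the sphere.\<close>

definition fischer :: "nat \<Rightarrow> (('n::finite \<Rightarrow> nat) \<Rightarrow> real) \<Rightarrow> (('n \<Rightarrow> nat) \<Rightarrow> real) \<Rightarrow> real" where
  "fischer k p q = (\<Sum>e\<in>exponents k. (\<Prod>i\<in>UNIV. fact (e i)) * p e * q e)"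

definition mult_var :: "'n \<Rightarrow> (('n \<Rightarrow> nat) \<Rightarrow> real) \<Rightarrow> ('n \<Rightarrow> nat) \<Rightarrow> real" where
  "mult_var i p e = (if e i = 0 then 0 else p (e(i := e i - 1)))"

definition deriv_var :: "'n \<Rightarrow> (('n \<Rightarrow> nat) \<Rightarrow> real) \<Rightarrow> ('n \<Rightarrow> nat) \<Rightarrow> real" where
  "deriv_var i p e = real (Suc (e i)) * p (e(i := Suc (e i)))"

definition mult_norm :: "(('n::finite \<Rightarrow> nat) \<Rightarrow> real) \<Rightarrow> ('n \<Rightarrow> nat) \<Rightarrow> real" where
  "mult_norm p e = (\<Sum>i\<in>UNIV. mult_var i (mult_var i p) e)"

definition laplacian :: "(('n::finite \<Rightarrow> nat) \<Rightarrow> real) \<Rightarrow> ('n \<Rightarrow> nat) \<Rightarrow> real" where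
  "laplacian p e = (\<Sum>i\<in>UNIV. deriv_var i (deriv_var i p) e)"

text \<open>
  The formal series \<open>exp (x \<bullet> z)\<close> in \<open>z\<close>, whose part of degree \<open>k\<close> is \<open>(x \<bullet> z)\<^sup>k / k!\<close>. It is an
  eigenvector of all partial derivatives, and the Fischer product with it is evaluation at \<open>x\<close>.
\<close>

definition exp_series :: "real ^ 'n \<Rightarrow> ('n::finite \<Rightarrow> nat) \<Rightarrow> real" where
  "exp_series x e = (\<Prod>i\<in>UNIV. (x $ i) ^ e i / fact (e i))"

section \<open>Formal calculus on coefficient functions\<close>

lemma finite_exponents [simp]: "finite (exponents k :: ('n::finite \<Rightarrow> nat) set)"
proof -
  have "exponents k \<subseteq> (PiE UNIV (\<lambda>_. {..k}) :: ('n \<Rightarrow> nat) set)"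
    by (auto simp: exponents_def intro: member_le_sum)
  then show ?thesis
    by (rule finite_subset) (simp add: finite_PiE)
qed

lemma sum_fun_upd_Suc: "sum (e(i := Suc (e i))) UNIV = Suc (sum e UNIV)"
  for e :: "'n::finite \<Rightarrow> nat"
  by (subst (1 2) sum.remove[of UNIV i]) (auto intro!: sum.cong)

lemma prod_fun_upd:
  fixes g :: "'n::finite \<Rightarrow> nat \<Rightarrow> real"
  shows "(\<Prod>j\<in>UNIV. g j ((e(i := m)) j)) = g i m * (\<Prod>j\<in>UNIV - {i}. g j (e j))"
  by (subst prod.remove[of UNIV i]) (auto intro!: prod.cong)

lemma exp_series_upd_Suc:
  "real (Suc (e i)) * exp_series x (e(i := Suc (e i))) = x $ i * exp_series x e"
proof -
  define P where "P = (\<Prod>j\<in>UNIV - {i}. (x $ j) ^ e j / fact (e j))"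
  have upd: "exp_series x (e(i := m)) = (x $ i) ^ m / fact m * P" for m
    unfolding exp_series_def P_def by (rule prod_fun_upd[where g = "\<lambda>j m. (x $ j) ^ m / fact m"])
  show ?thesis
    using upd[of "Suc (e i)"] upd[of "e i"] by (simp del: of_nat_Suc)
qed

lemma deriv_var_exp_series: "deriv_var i (exp_series x) = (\<lambda>e. x $ i * exp_series x e)"
  by (simp add: fun_eq_iff deriv_var_def exp_series_upd_Suc del: of_nat_Suc)

lemma deriv_var_scale: "deriv_var i (\<lambda>e. c * p e) = (\<lambda>e. c * deriv_var i p e)"
  by (simp add: fun_eq_iff deriv_var_def)

lemma laplacian_exp_series: "laplacian (exp_series x) e = (norm x)\<^sup>2 * exp_series x e"
  unfolding laplacian_def deriv_var_exp_series deriv_var_scale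
  by (simp add: power2_norm_eq_inner inner_vec_def sum_distrib_right mult.assoc)

text \<open>The commutator of the Laplacian with |z|^2 is 4E + 2n, where the Euler operator E
  multiplies a coefficient by its degree. Only equal indices contribute: (m+2)(m+1) - m(m-1) = 4m +
  2.\<close>

lemma laplacian_mult_norm:
  fixes p :: "('n::finite \<Rightarrow> nat) \<Rightarrow> real"
  shows "laplacian (mult_norm p) e = mult_norm (laplacian p) e + (4 * real (sum e UNIV) + 2 * real CARD('n)) * p e"
proof -
  have swap: "deriv_var i (deriv_var i (mult_var j (mult_var j p))) e =
      mult_var j (mult_var j (deriv_var i (deriv_var i p))) e + (if i = j then (4 * real (e i) + 2) * p e else 0)"
    for i j
  proof (cases "i = j")
    case True
    have same: "e(i := m) = e" if "m = e i" for m
      using that by auto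
    \<comment> \<open>For exponents 0 and 1 the iterated \<open>mult_var\<close> takes its default
      value 0, in accordance with m(m-1) = 0.\<close>
    have zero: ?thesis if "e i = 0"
      using that same[OF that[symmetric]] \<open>i = j\<close> by (simp add: deriv_var_def mult_var_def)
    have one: ?thesis if "e i = Suc 0"
      using that same[OF that[symmetric]] \<open>i = j\<close> by (simp add: deriv_var_def mult_var_def)
    show ?thesis
    proof (cases "e i \<ge> 2")
      case True
      then obtain m where m: "e i = Suc (Suc m)"
        by (metis add_2_eq_Suc le_Suc_ex)
      from same[OF m[symmetric]] m \<open>i = j\<close> show ?thesis
        by (simp add: deriv_var_def mult_var_def) (simp add: algebra_simps)
    next
      case False
      then have "e i = 0 \<or> e i = Suc 0"
        by auto
      then show ?thesis
        using zero one by blast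
    qed
  next
    case False
    then show ?thesis
      by (auto simp: deriv_var_def mult_var_def fun_upd_twist)
  qed
  have "laplacian (mult_norm p) e = (\<Sum>i\<in>UNIV. \<Sum>j\<in>UNIV. deriv_var i (deriv_var i (mult_var j (mult_var j p))) e)"
    unfolding laplacian_def mult_norm_def
    by (simp add: deriv_var_def sum_distrib_left)
  also have "\<dots> = (\<Sum>i\<in>UNIV. \<Sum>j\<in>UNIV. mult_var j (mult_var j (deriv_var i (deriv_var i p))) e)
      + (\<Sum>i\<in>UNIV. (4 * real (e i) + 2) * p e)"
    unfolding swap by (simp add: sum.distrib)
  also have "(\<Sum>i\<in>UNIV. \<Sum>j\<in>UNIV. mult_var j (mult_var j (deriv_var i (deriv_var i p))) e) = mult_norm (laplacian p) e"
    unfolding laplacian_def mult_norm_def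
    by (subst sum.swap) (auto simp: mult_var_def intro!: sum.cong)
  also have "(\<Sum>i\<in>UNIV. (4 * real (e i) + 2) * p e) = (4 * real (sum e UNIV) + 2 * real CARD('n)) * p e"
    by (simp add: sum.distrib sum_distrib_left flip: sum_distrib_right)
  finally show ?thesis .
qed

text \<open>Multiplication by |z|^2 raises the degree by exactly 2. This replaces homogeneity
  wherever a factor that depends on the degree has to be pulled out of
  \<open>mult_norm\<close>.\<close>

lemma mult_norm_degree:
  fixes p q :: "('n::finite \<Rightarrow> nat) \<Rightarrow> real"
  assumes "\<And>e'. sum e' UNIV + 2 = sum e UNIV \<Longrightarrow> p e' = q e'"
  shows "mult_norm p e = mult_norm q e"
proof -
  have "p (e(i := e i - 2)) = q (e(i := e i - 2))" if "e i \<ge> 2" for i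
  proof (rule assms)
    have "sum e UNIV = e i + sum e (UNIV - {i})" "sum (e(i := e i - 2)) UNIV = (e i - 2) + sum e (UNIV - {i})"
      by (subst sum.remove[of UNIV i]; auto intro!: sum.cong)+
    then show "sum (e(i := e i - 2)) UNIV + 2 = sum e UNIV"
      using that by simp
  qed
  then have "mult_var i (mult_var i p) e = mult_var i (mult_var i q) e" for i
    by (cases "e i \<ge> 2") (auto simp: mult_var_def numeral_2_eq_2)
  then show ?thesis
    by (simp add: mult_norm_def)
qed

lemma mult_norm_add: "mult_norm (\<lambda>e. p e + q e) e = mult_norm p e + mult_norm q e"
proof -
  have "mult_var i (mult_var i (\<lambda>e. p e + q e)) e = mult_var i (mult_var i p) e + mult_var i (mult_var i q) e" for i
    by (simp add: mult_var_def)
  then show ?thesis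
    by (simp add: mult_norm_def sum.distrib)
qed

lemma mult_norm_scale: "mult_norm (\<lambda>e. c * p e) e = c * mult_norm p e"
proof -
  have "mult_var i (mult_var i (\<lambda>e. c * p e)) e = c * mult_var i (mult_var i p) e" for i
    by (simp add: mult_var_def)
  then show ?thesis
    by (simp add: mult_norm_def sum_distrib_left)
qed

lemma mult_norm_pow_low_degree:
  "sum e UNIV < 2 * j \<Longrightarrow> (mult_norm ^^ j) p e = 0"
proof (induction j arbitrary: e)
  case (Suc j)
  have "mult_norm ((mult_norm ^^ j) p) e = mult_norm (\<lambda>_. 0) e"
    by (rule mult_norm_degree) (use Suc in auto)
  also have "\<dots> = 0"
    using mult_norm_scale[of 0 "\<lambda>_. 0" e] by simp
  finally show ?case by simp
qed simp

text \<open>The commutator, iterated on an eigenvector of the Laplacian. The degree enters as that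
  of the coefficient inspected, so one identity covers all homogeneous parts of the series.\<close>

lemma laplacian_mult_norm_pow:
  fixes x :: "real ^ 'n::finite"
  shows "laplacian ((mult_norm ^^ j) (exp_series x)) e =
    (norm x)\<^sup>2 * (mult_norm ^^ j) (exp_series x) e +
    (if j = 0 then 0 else 2 * real j * (real CARD('n) + 2 * real (sum e UNIV) - 2 * real j + 2)
      * (mult_norm ^^ (j - 1)) (exp_series x) e)"
proof (induction j arbitrary: e)
  case 0
  then show ?case by (simp add: laplacian_exp_series)
next
  case (Suc j)
  let ?R = "\<lambda>j. (mult_norm ^^ j) (exp_series x)"
  \<comment> \<open>The degree in the induction hypothesis is frozen at |e| - 2, the only degree
    that \<open>mult_norm\<close> reads at \<open>e\<close>.\<close>
  have "mult_norm (laplacian (?R j)) e = mult_norm (\<lambda>e'. (norm x)\<^sup>2 * ?R j e' +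
      (if j = 0 then 0 else 2 * real j * (real CARD('n) + 2 * (real (sum e UNIV) - 2) - 2 * real j + 2)) * ?R (j - 1) e') e"
  proof (rule mult_norm_degree)
    fix e' :: "'n \<Rightarrow> nat"
    assume "sum e' UNIV + 2 = sum e UNIV"
    then have "real (sum e' UNIV) = real (sum e UNIV) - 2"
      by linarith
    then show "laplacian (?R j) e' = (norm x)\<^sup>2 * ?R j e' +
      (if j = 0 then 0 else 2 * real j * (real CARD('n) + 2 * (real (sum e UNIV) - 2) - 2 * real j + 2)) * ?R (j - 1) e'"
      unfolding Suc.IH by simp
  qed
  also have "\<dots> = (norm x)\<^sup>2 * ?R (Suc j) e +
      (if j = 0 then 0 else 2 * real j * (real CARD('n) + 2 * (real (sum e UNIV) - 2) - 2 * real j + 2)) * ?R j e"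
    unfolding mult_norm_add mult_norm_scale by (cases j) simp_all
  finally show ?case
    using laplacian_mult_norm[of "?R j" e] by (simp add: algebra_simps split: if_splits)
qed

section \<open>The Fischer product and its adjoint pairs\<close>

lemma fischer_sym: "fischer k p q = fischer k q p"
  by (simp add: fischer_def ac_simps)

lemma fischer_cong:
  "(\<And>e. sum e UNIV = k \<Longrightarrow> p e = p' e) \<Longrightarrow> (\<And>e. sum e UNIV = k \<Longrightarrow> q e = q' e) \<Longrightarrow>
    fischer k p q = fischer k p' q'"
  unfolding fischer_def by (rule sum.cong) (auto simp: exponents_def)

lemma fischer_sum_left: "fischer k (\<lambda>e. \<Sum>a\<in>A. c a * p a e) q = (\<Sum>a\<in>A. c a * fischer k (p a) q)"
  unfolding fischer_def
  by (simp add: sum_distrib_left sum_distrib_right ac_simps) (subst sum.swap, simp)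

lemma fischer_scale_left: "fischer k (\<lambda>e. c * p e) q = c * fischer k p q"
  by (simp add: fischer_def sum_distrib_left ac_simps)

text \<open>Shifting the exponent of \<open>i\<close> by one changes the factorial weight by exactly
  the factor that differentiation produces.\<close>

lemma fischer_mult_var:
  fixes p q :: "('n::finite \<Rightarrow> nat) \<Rightarrow> real"
  shows "fischer (Suc k) (mult_var i p) q = fischer k p (deriv_var i q)"
proof -
  let ?w = "\<lambda>e::'n \<Rightarrow> nat. \<Prod>i\<in>UNIV. (fact (e i) :: real)"
  have "fischer (Suc k) (mult_var i p) q =
    (\<Sum>e\<in>{e \<in> exponents (Suc k). e i \<noteq> 0}. ?w e * p (e(i := e i - 1)) * q e)"
    unfolding fischer_def
    by (rule sum.mono_neutral_cong_right) (auto simp: mult_var_def)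
  also have "\<dots> = (\<Sum>e\<in>exponents k. ?w (e(i := Suc (e i))) * p e * q (e(i := Suc (e i))))"
  proof (rule sum.reindex_bij_witness[of _ "\<lambda>e. e(i := Suc (e i))" "\<lambda>e. e(i := e i - 1)"])
    fix e :: "'n \<Rightarrow> nat"
    assume e: "e \<in> {e \<in> exponents (Suc k). e i \<noteq> 0}"
    show "(e(i := e i - 1))(i := Suc ((e(i := e i - 1)) i)) = e"
      using e by auto
    then show "e(i := e i - 1) \<in> exponents k"
      using e sum_fun_upd_Suc[of "e(i := e i - 1)" i] by (simp add: exponents_def)
  qed (auto simp: exponents_def sum_fun_upd_Suc simp del: fun_upd_apply, auto)
  also have "\<dots> = fischer k p (deriv_var i q)"
    unfolding fischer_def
  proof (rule sum.cong)
    fix e :: "'n \<Rightarrow> nat"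
    have "?w (e(i := Suc (e i))) = real (Suc (e i)) * ?w (e(i := e i))"
      unfolding prod_fun_upd[where g = "\<lambda>_ m. fact m"] by simp
    then show "?w (e(i := Suc (e i))) * p e * q (e(i := Suc (e i))) = ?w e * p e * deriv_var i q e"
      by (simp add: deriv_var_def)
  qed simp
  finally show ?thesis .
qed

lemma fischer_mult_norm: "fischer (Suc (Suc k)) (mult_norm p) q = fischer k p (laplacian q)"
proof -
  have "fischer (Suc (Suc k)) (mult_norm p) q = (\<Sum>i\<in>UNIV. fischer (Suc (Suc k)) (mult_var i (mult_var i p)) q)"
    using fischer_sum_left[of _ "\<lambda>e. 1" "\<lambda>i. mult_var i (mult_var i p)" UNIV] by (simp add: mult_norm_def[abs_def])
  also have "\<dots> = (\<Sum>i\<in>UNIV. fischer k p (deriv_var i (deriv_var i q)))"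
    by (simp add: fischer_mult_var)
  also have "\<dots> = fischer k p (laplacian q)"
    using fischer_sum_left[of _ "\<lambda>e. 1" "\<lambda>i. deriv_var i (deriv_var i q)" UNIV]
    by (simp add: laplacian_def[abs_def] fischer_sym[of k p])
  finally show ?thesis .
qed

lemma fischer_exp_series: "fischer k (exp_series x) (exp_series y) = (x \<bullet> y) ^ k / fact k"
proof (induction k)
  case 0
  have "exponents 0 = {\<lambda>_::'a. 0::nat}"
    by (auto simp: exponents_def)
  then show ?case
    by (simp add: fischer_def exp_series_def)
next
  case (Suc k)
  \<comment> \<open>Euler's identity: multiplication by \<open>x $ i\<close> and z_i acts on the
    exponential series as z_i d/dz_i.\<close>
  have "real (Suc k) * fischer (Suc k) (exp_series x) (exp_series y) =
      fischer (Suc k) (\<lambda>e. \<Sum>i\<in>UNIV. x $ i * mult_var i (exp_series x) e) (exp_series y)"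
    unfolding fischer_scale_left[symmetric]
  proof (rule fischer_cong)
    fix e :: "'a \<Rightarrow> nat"
    assume "sum e UNIV = Suc k"
    moreover have "x $ i * mult_var i (exp_series x) e = real (e i) * exp_series x e" for i
      using exp_series_upd_Suc[of "e(i := e i - 1)" i x] by (auto simp: mult_var_def)
    ultimately show "real (Suc k) * exp_series x e = (\<Sum>i\<in>UNIV. x $ i * mult_var i (exp_series x) e)"
      by (simp add: sum_distrib_right[symmetric] flip: of_nat_sum del: of_nat_Suc)
  qed simp
  also have "\<dots> = (\<Sum>i\<in>UNIV. x $ i * (y $ i * fischer k (exp_series x) (exp_series y)))"
    by (simp add: fischer_sum_left fischer_mult_var deriv_var_exp_series fischer_sym[of k "exp_series x"] fischer_scale_left)
  also have "\<dots> = (x \<bullet> y) * ((x \<bullet> y) ^ k / fact k)"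
    unfolding Suc inner_vec_def by (simp add: sum_distrib_right mult.assoc flip: sum_divide_distrib)
  finally show ?case
    by (simp add: field_simps del: of_nat_Suc)
qed

text \<open>Each factor |z|^2 moves across as a Laplacian, of which \<open>exp_series x\<close> is
  an eigenvector with eigenvalue |x|^2.\<close>

lemma fischer_exp_series_mult_norm_pow:
  "2 * j \<le> k \<Longrightarrow> fischer k (exp_series x) ((mult_norm ^^ j) (exp_series y)) =
    (norm x) ^ (2 * j) * ((x \<bullet> y) ^ (k - 2 * j) / fact (k - 2 * j))"
proof (induction j arbitrary: k)
  case 0
  then show ?case by (simp add: fischer_exp_series)
next
  case (Suc j)
  then obtain k' where k: "k = Suc (Suc k')" "2 * j \<le> k'"
    by (cases k; cases "k - 1") auto
  have "fischer k (exp_series x) ((mult_norm ^^ Suc j) (exp_series y)) =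
      fischer k' ((mult_norm ^^ j) (exp_series y)) (\<lambda>e. (norm x)\<^sup>2 * exp_series x e)"
    unfolding k fischer_sym[of _ "exp_series x"]
    by (simp add: fischer_mult_norm laplacian_exp_series[abs_def])
  also have "\<dots> = (norm x)\<^sup>2 * fischer k' (exp_series x) ((mult_norm ^^ j) (exp_series y))"
    by (simp add: fischer_sym[of _ "(mult_norm ^^ j) (exp_series y)"] fischer_scale_left)
  finally show ?case
    using Suc.IH[OF k(2)] k by (simp add: power2_eq_square)
qed

text \<open>
  The recursion is the condition that the part of degree \<open>k\<close> of \<open>zonal k x\<close> is harmonic. The
  polynomials \<open>gegenbauer n k\<close> have leading coefficient \<open>1 / k!\<close> instead of the value \<open>1\<close> at \<open>1\<close>.
\<close>

fun zonal_coeff :: "nat \<Rightarrow> nat \<Rightarrow> nat \<Rightarrow> real" where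
  "zonal_coeff n k 0 = 1"
| "zonal_coeff n k (Suc j) =
    - zonal_coeff n k j / (2 * (real j + 1) * (real n + 2 * real k - 2 * real j - 4))"

definition gegenbauer :: "nat \<Rightarrow> nat \<Rightarrow> real \<Rightarrow> real" where
  "gegenbauer n k t = (\<Sum>j\<le>k div 2. zonal_coeff n k j * (t ^ (k - 2 * j) / fact (k - 2 * j)))"

definition zonal :: "nat \<Rightarrow> real ^ 'n \<Rightarrow> ('n::finite \<Rightarrow> nat) \<Rightarrow> real" where
  "zonal k x e = (\<Sum>j\<le>k div 2. zonal_coeff CARD('n) k j * norm x ^ (2 * j) * (mult_norm ^^ j) (exp_series x) e)"

lemma laplacian_sum:
  "laplacian (\<lambda>e. \<Sum>a\<in>A. c a * p a e) e = (\<Sum>a\<in>A. c a * laplacian (p a) e)"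
  unfolding laplacian_def deriv_var_def
  by (simp add: sum_distrib_left ac_simps) (subst sum.swap, simp)

text \<open>By the recursion the terms contribute h_j - h_(j-1). The sum telescopes to h at j = k
  div 2, which vanishes because |z|^(2j) times a series has no coefficient of degree k - 2 <
  2j.\<close>

lemma laplacian_zonal:
  fixes x :: "real ^ 'n::finite"
  assumes "sum e UNIV + 2 = k"
  shows "laplacian (zonal k x) e = 0"
proof -
  let ?R = "\<lambda>j. (mult_norm ^^ j) (exp_series x) e"
  let ?b = "zonal_coeff CARD('n) k"
  define h where "h j = ?b j * norm x ^ (2 * j + 2) * ?R j" for j
  have summand: "?b j * norm x ^ (2 * j) * laplacian ((mult_norm ^^ j) (exp_series x)) e =
      h j - (if j = 0 then 0 else h (j - 1))" if "j \<le> k div 2" for j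
  proof (cases j)
    case 0
    then show ?thesis
      by (simp add: h_def laplacian_exp_series power2_eq_square)
  next
    case (Suc i)
    have "real CARD('n) \<ge> 1"
      using zero_less_card_finite[where 'a='n] by linarith
    moreover have k: "real (sum e UNIV) = real k - 2"
      using assms by linarith
    moreover have "2 * real i + 2 \<le> real k"
      using that Suc by linarith
    ultimately have d: "real CARD('n) + 2 * real k - 2 * real i - 4 > 0"
      using assms by linarith
    have "?b j * (2 * real j * (real CARD('n) + 2 * real (sum e UNIV) - 2 * real j + 2)) = - ?b i"
    proof -
      define D where "D = real CARD('n) + 2 * real k - 2 * real i - 4"
      have "2 * real j * (real CARD('n) + 2 * real (sum e UNIV) - 2 * real j + 2) = 2 * (real i + 1) * D"
        unfolding k Suc D_def by (simp add: algebra_simps)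
      moreover have "?b j = - ?b i / (2 * (real i + 1) * D)"
        by (simp add: Suc D_def)
      moreover have "2 * (real i + 1) * D \<noteq> 0"
        using d by (simp add: D_def)
      ultimately show ?thesis by simp
    qed
    then have "?b j * (2 * real j * (real CARD('n) + 2 * real (sum e UNIV) - 2 * real j + 2))
        * (norm x ^ (2 * j) * ?R i) = - h i"
      by (simp add: h_def Suc)
    moreover have "?b j * norm x ^ (2 * j) * laplacian ((mult_norm ^^ j) (exp_series x)) e = h j +
        ?b j * (2 * real j * (real CARD('n) + 2 * real (sum e UNIV) - 2 * real j + 2))
        * (norm x ^ (2 * j) * ?R i)"
    proof -
      have "b * N * (M * r + c * s) = b * (N * M) * r + b * c * (N * s)" for b N M r c s :: real
        by (simp add: algebra_simps)
      moreover have "laplacian ((mult_norm ^^ j) (exp_series x)) e = (norm x)\<^sup>2 * ?R j +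
          (2 * real j * (real CARD('n) + 2 * real (sum e UNIV) - 2 * real j + 2)) * ?R i"
        using laplacian_mult_norm_pow[of j x e] by (simp add: Suc del: funpow.simps)
      ultimately show ?thesis
        by (simp only: h_def power_add[of "norm x" "2 * j" 2])
    qed
    ultimately show ?thesis
      by (simp add: Suc)
  qed
  have tele: "(\<Sum>j\<le>m. h j - (if j = 0 then 0 else h (j - 1))) = h m" for m
    by (induction m) auto
  have "laplacian (zonal k x) e = (\<Sum>j\<le>k div 2. ?b j * norm x ^ (2 * j) * laplacian ((mult_norm ^^ j) (exp_series x)) e)"
    unfolding zonal_def[abs_def] laplacian_sum ..
  also have "\<dots> = (\<Sum>j\<le>k div 2. h j - (if j = 0 then 0 else h (j - 1)))"
    by (rule sum.cong) (simp_all only: summand atMost_iff)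
  also have "\<dots> = h (k div 2)"
    by (rule tele)
  also have "\<dots> = 0"
    using assms by (simp add: h_def mult_norm_pow_low_degree)
  finally show ?thesis .
qed

text \<open>\<open>zonal k y\<close> is harmonic in degree \<open>k\<close>, hence orthogonal to
  every term of \<open>zonal k x\<close> with a factor |z|^2. The one remaining pairing, with
  \<open>exp_series x\<close>, evaluates it at \<open>x\<close>. So the Gegenbauer kernel is a Gram
  kernel.\<close>

lemma fischer_zonal:
  fixes x y :: "real ^ 'n::finite"
  assumes "norm x = 1" "norm y = 1"
  shows "fischer k (zonal k x) (zonal k y) = gegenbauer CARD('n) k (x \<bullet> y)"
proof -
  have orth: "fischer k ((mult_norm ^^ j) (exp_series x)) (zonal k y) = 0" if j: "j \<noteq> 0" "j \<le> k div 2" for j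
  proof -
    obtain i where i: "j = Suc i" using j by (cases j) auto
    with j obtain m where m: "k = Suc (Suc m)"
      by (cases k; cases "k - 1") auto
    have "fischer k ((mult_norm ^^ j) (exp_series x)) (zonal k y) =
        fischer m ((mult_norm ^^ i) (exp_series x)) (laplacian (zonal k y))"
      by (simp add: i m fischer_mult_norm)
    also have "\<dots> = fischer m ((mult_norm ^^ i) (exp_series x)) (\<lambda>_. 0)"
      by (rule fischer_cong) (auto simp: m laplacian_zonal)
    finally show ?thesis by (simp add: fischer_def)
  qed
  have "fischer k (zonal k x) (zonal k y) =
      (\<Sum>j\<le>k div 2. zonal_coeff CARD('n) k j * norm x ^ (2 * j) * fischer k ((mult_norm ^^ j) (exp_series x)) (zonal k y))"
    by (subst (1) zonal_def[abs_def]) (rule fischer_sum_left)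
  also have "\<dots> = (\<Sum>j\<le>k div 2. if j = 0 then fischer k (exp_series x) (zonal k y) else 0)"
    by (rule sum.cong) (auto simp: orth)
  also have "\<dots> = fischer k (zonal k y) (exp_series x)"
    by (simp add: fischer_sym)
  also have "\<dots> = (\<Sum>j\<le>k div 2. zonal_coeff CARD('n) k j * norm y ^ (2 * j) *
      fischer k (exp_series x) ((mult_norm ^^ j) (exp_series y)))"
    by (subst zonal_def[abs_def]) (simp only: fischer_sum_left fischer_sym[of _ _ "exp_series x"])
  also have "\<dots> = gegenbauer CARD('n) k (x \<bullet> y)"
    unfolding gegenbauer_def using assms by (intro sum.cong) (auto simp: fischer_exp_series_mult_norm_pow)
  finally show ?thesis .
qed

lemma gegenbauer_sum_fischer:
  fixes C :: "(real ^ 'n::finite) set"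
  assumes "D \<subseteq> sphere 0 1" "C \<subseteq> sphere 0 1"
  shows "(\<Sum>x\<in>D. \<Sum>y\<in>C. gegenbauer CARD('n) k (x \<bullet> y)) =
    fischer k (\<lambda>e. \<Sum>x\<in>D. zonal k x e) (\<lambda>e. \<Sum>y\<in>C. zonal k y e)"
proof -
  have "fischer k (\<lambda>e. \<Sum>x\<in>D. zonal k x e) (\<lambda>e. \<Sum>y\<in>C. zonal k y e) =
      (\<Sum>x\<in>D. \<Sum>y\<in>C. fischer k (zonal k x) (zonal k y))"
  proof -
    have "fischer k (\<lambda>e. \<Sum>x\<in>D. zonal k x e) q = (\<Sum>x\<in>D. fischer k (zonal k x) q)"
      for D :: "(real ^ 'n) set" and q
      using fischer_sum_left[of k "\<lambda>_. 1" "zonal k" D q] by simp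
    then show ?thesis
      by (simp only: fischer_sym[of k "zonal k _" "\<lambda>e. \<Sum>y\<in>C. zonal k y e"])
        (simp only: fischer_sym[of k "zonal k _" "zonal k _"])
  qed
  also have "\<dots> = (\<Sum>x\<in>D. \<Sum>y\<in>C. gegenbauer CARD('n) k (x \<bullet> y))"
    using assms by (intro sum.cong fischer_zonal) auto
  finally show ?thesis ..
qed

lemma gegenbauer_sum_nonneg:
  fixes C :: "(real ^ 'n::finite) set"
  assumes "C \<subseteq> sphere 0 1"
  shows "(\<Sum>x\<in>C. \<Sum>y\<in>C. gegenbauer CARD('n) k (x \<bullet> y)) \<ge> 0"
  unfolding gegenbauer_sum_fischer[OF assms assms] fischer_def
  by (intro sum_nonneg) (simp add: mult.assoc prod_nonneg)

text \<open>The double sum is the squared Fischer norm of the summed zonal polynomials. If it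
  vanishes, so does their part of degree \<open>k\<close>, and with it the pairing with any unit
  vector: the design property in degree \<open>k\<close>.\<close>

lemma gegenbauer_sum_eq_0:
  fixes C :: "(real ^ 'n::finite) set"
  assumes C: "C \<subseteq> sphere 0 1" and "norm x = 1"
    and 0: "(\<Sum>x\<in>C. \<Sum>y\<in>C. gegenbauer CARD('n) k (x \<bullet> y)) = 0"
  shows "(\<Sum>y\<in>C. gegenbauer CARD('n) k (x \<bullet> y)) = 0"
proof -
  have "\<forall>e\<in>exponents k. (\<Prod>i\<in>UNIV. fact (e i)) * (\<Sum>x\<in>C. zonal k x e) * (\<Sum>x\<in>C. zonal k x e) = 0"
    using 0 unfolding gegenbauer_sum_fischer[OF C C] fischer_def
    by (subst (asm) sum_nonneg_eq_0_iff) (auto simp: mult.assoc prod_nonneg)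
  then have "\<forall>e\<in>exponents k. (\<Sum>x\<in>C. zonal k x e) = 0"
    by simp
  then show ?thesis
    using gegenbauer_sum_fischer[of "{x}" C k] assms by (simp add: fischer_def)
qed

section \<open>Linear programming bounds\<close>

lemma gegenbauer_0 [simp]: "gegenbauer n 0 t = 1"
  by (simp add: gegenbauer_def)

lemma sum_gegenbauer_expansion:
  fixes C D :: "(real ^ 'n::finite) set"
  assumes "\<And>t. f t = (\<Sum>k\<le>d. c k * gegenbauer CARD('n) k t)"
  shows "(\<Sum>x\<in>C. \<Sum>y\<in>D. f (x \<bullet> y)) =
    (\<Sum>k\<le>d. c k * (\<Sum>x\<in>C. \<Sum>y\<in>D. gegenbauer CARD('n) k (x \<bullet> y)))"
proof -
  have "(\<Sum>x\<in>C. \<Sum>y\<in>D. f (x \<bullet> y)) =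
      (\<Sum>x\<in>C. \<Sum>k\<le>d. \<Sum>y\<in>D. c k * gegenbauer CARD('n) k (x \<bullet> y))"
    unfolding assms by (subst sum.swap) simp
  also have "\<dots> = (\<Sum>k\<le>d. \<Sum>x\<in>C. \<Sum>y\<in>D. c k * gegenbauer CARD('n) k (x \<bullet> y))"
    by (rule sum.swap)
  finally show ?thesis
    by (simp add: sum_distrib_left)
qed

text \<open>Delsarte's argument: in the sum of \<open>f\<close> over all ordered pairs, keep from
  below only the term of degree 0 and from above only the diagonal.\<close>

lemma linear_programming_bound:
  fixes C :: "(real ^ 'n::finite) set"
  assumes C: "spherical_code C"
    and f: "\<And>t. f t = (\<Sum>k\<le>d. c k * gegenbauer CARD('n) k t)"
    and c: "\<And>k. k \<le> d \<Longrightarrow> c k \<ge> 0"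
    and nonpos: "\<And>x y. x \<in> C \<Longrightarrow> y \<in> C \<Longrightarrow> x \<noteq> y \<Longrightarrow> f (x \<bullet> y) \<le> 0"
    and "f 1 \<ge> 0"
  shows "c 0 * real (card C) \<le> f 1"
proof (cases "C = {}")
  case False
  have fin: "finite C" and sph: "C \<subseteq> sphere 0 1"
    using C by (auto simp: spherical_code_def)
  have "c 0 * (real (card C))\<^sup>2 \<le> (\<Sum>k\<le>d. c k * (\<Sum>x\<in>C. \<Sum>y\<in>C. gegenbauer CARD('n) k (x \<bullet> y)))"
    using member_le_sum[of 0 "{..d}" "\<lambda>k. c k * (\<Sum>x\<in>C. \<Sum>y\<in>C. gegenbauer CARD('n) k (x \<bullet> y))"]
    by (simp add: c gegenbauer_sum_nonneg[OF sph] power2_eq_square)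
  also have "\<dots> = (\<Sum>x\<in>C. \<Sum>y\<in>C. f (x \<bullet> y))"
    by (rule sum_gegenbauer_expansion[OF f, symmetric])
  also have "\<dots> \<le> (\<Sum>x\<in>C. \<Sum>y\<in>C. if y = x then f 1 else 0)"
  proof (intro sum_mono)
    fix x y assume "x \<in> C" "y \<in> C"
    then show "f (x \<bullet> y) \<le> (if y = x then f 1 else 0)"
      using nonpos[of x y] sph by (auto simp: norm_eq_1)
  qed
  also have "\<dots> = f 1 * real (card C)"
    using fin by simp
  finally show ?thesis
    using False fin by (simp add: power2_eq_square mult.assoc[symmetric] card_gt_0_iff)
qed (use assms in simp)

section \<open>Explicit polynomials in dimensions 23 and 24\<close>

lemma zonal_coeff_numeral:
  "zonal_coeff n k (numeral w) =
    - zonal_coeff n k (pred_numeral w) / (2 * (real (pred_numeral w) + 1) * (real n + 2 * real k - 2 * real (pred_numeral w) - 4))"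
  by (simp only: numeral_eq_Suc zonal_coeff.simps)

lemma gegenbauer_23:
    "gegenbauer 23 (Suc 0) t = t"
  "gegenbauer 23 2 t = 1/2 * t ^ 2 - 1/46"
  "gegenbauer 23 3 t = 1/6 * t ^ 3 - 1/50 * t"
  "gegenbauer 23 4 t = 1/24 * t ^ 4 - 1/108 * t ^ 2 + 1/5400"
  "gegenbauer 23 5 t = 1/120 * t ^ 5 - 1/348 * t ^ 3 + 1/6264 * t"
  "gegenbauer 23 6 t = 1/720 * t ^ 6 - 1/1488 * t ^ 4 + 1/14384 * t ^ 2 - 1/1165104"
  "gegenbauer 23 7 t = 1/5040 * t ^ 7 - 1/7920 * t ^ 5 + 1/49104 * t ^ 3 - 1/1424016 * t"
  by (simp_all add: gegenbauer_def atMost_nat_numeral zonal_coeff_numeral fact_numeral)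

text \<open>Even degrees suffice because the test polynomials in dimension 24 are even.\<close>

lemma gegenbauer_24:
    "gegenbauer 24 2 t = 1/2 * t ^ 2 - 1/48"
  "gegenbauer 24 4 t = 1/24 * t ^ 4 - 1/112 * t ^ 2 + 1/5824"
  "gegenbauer 24 6 t = 1/720 * t ^ 6 - 1/1536 * t ^ 4 + 1/15360 * t ^ 2 - 1/1290240"
  by (simp_all add: gegenbauer_def atMost_nat_numeral zonal_coeff_numeral fact_numeral)

lemma card_le_47104:
  fixes C :: "(real ^ 'n::finite) set" and f :: "real \<Rightarrow> real"
  assumes n: "CARD('n) = 23" and C: "spherical_code C" and le: "\<And>x y. x \<in> C \<Longrightarrow> y \<in> C \<Longrightarrow> x \<noteq> y \<Longrightarrow> x \<bullet> y \<le> 7/15"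
    and T: "T \<in> {{-3/5 <..< -1/3}, {-1/3 <..< -1/15}, {-1/15 <..< 1/5}}" and avoid: "avoiding T C"
  shows "card C \<le> 47104"
proof -
  have notin: "x \<bullet> y \<notin> T" if "x \<in> C" "y \<in> C" "x \<noteq> y" for x y
    using avoid that by (auto simp: avoiding_def inner_products_def)
  have bound: "card C \<le> 47104"
    if f: "\<And>t. f t = (\<Sum>k\<le>7. c ! k * gegenbauer CARD('n) k t)"
      and c: "\<And>k. k \<le> 7 \<Longrightarrow> c ! k \<ge> 0" "c ! 0 > 0" "47104 * c ! 0 = f 1"
      and nonpos: "\<And>t. t \<le> 7/15 \<Longrightarrow> t \<notin> T \<Longrightarrow> f t \<le> 0" for f c
  proof -
    have "c ! 0 * real (card C) \<le> f 1"
      using linear_programming_bound[OF C f c(1)] nonpos le notin c(2,3) by auto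
    then show ?thesis
      unfolding c(3)[symmetric] using c(2) by simp
  qed
  \<comment> \<open>The sign can fail only between the simple roots \<open>a\<close> and
    \<open>b\<close>, the end points of \<open>T\<close>; \<open>w\<close> collects the double
    roots.\<close>
  have sgn: "(t - a) * (t - b) * w * (t - 7/15) \<le> 0"
    if "t \<le> 7/15" "t \<notin> {a <..< b}" "w \<ge> 0" "a \<le> b" for t a b w :: real
  proof -
    have "(t - a) * (t - b) \<ge> 0"
      using that by (cases "t \<le> a") (auto intro: mult_nonpos_nonpos)
    then show ?thesis
      using that by (intro mult_nonneg_nonpos) auto
  qed
  consider "T = {-3/5 <..< -1/3}" | "T = {-1/3 <..< -1/15}" | "T = {-1/15 <..< 1/5}"
    using T by blast
  then show ?thesis
  proof cases
    case 1
    show ?thesis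
    proof (rule bound)
      \<comment> \<open>Expansion from the top degree down: 5040 = 7! compensates the leading
        coefficient 1/7!, and 144 is 6!/5 since the roots add up to -1/5.\<close>
      let ?c = "[512/29109375, 1024/4078125, 22784/2446875, 1676032/15170625, 3664/2325, 5296/165, 144, 5040] :: real list"
      show "(t - (-3/5)) * (t - (-1/3)) * ((t + 1/15)\<^sup>2 * (t - 1/5)\<^sup>2) * (t - 7/15) =
          (\<Sum>k\<le>7. ?c ! k * gegenbauer CARD('n) k t)" for t :: real
        by (simp add: n atMost_nat_numeral gegenbauer_23) (simp add: field_simps eval_nat_numeral)
      show "(t - (-3/5)) * (t - (-1/3)) * ((t + 1/15)\<^sup>2 * (t - 1/5)\<^sup>2) * (t - 7/15) \<le> 0"
        if "t \<le> 7/15" "t \<notin> T" for t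
        using that by (intro sgn) (auto simp: 1)
    qed (auto simp: power2_eq_square nth_Cons')
  next
    case 2
    show ?thesis
    proof (rule bound)
      let ?c = "[256/9703125, 3328/7340625, 269312/22021875, 1206784/5056875, 20464/6975, 6704/165, 528, 5040] :: real list"
      show "(t - (-1/3)) * (t - (-1/15)) * ((t + 3/5)\<^sup>2 * (t - 1/5)\<^sup>2) * (t - 7/15) =
          (\<Sum>k\<le>7. ?c ! k * gegenbauer CARD('n) k t)" for t :: real
        by (simp add: n atMost_nat_numeral gegenbauer_23) (simp add: field_simps eval_nat_numeral)
      show "(t - (-1/3)) * (t - (-1/15)) * ((t + 3/5)\<^sup>2 * (t - 1/5)\<^sup>2) * (t - 7/15) \<le> 0"
        if "t \<le> 7/15" "t \<notin> T" for t
        using that by (intro sgn) (auto simp: 2)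
    qed (auto simp: power2_eq_square nth_Cons')
  next
    case 3
    show ?thesis
    proof (rule bound)
      let ?c = "[256/5821875, 10496/12234375, 444928/22021875, 6874112/15170625, 53744/6975, 1104/11, 912, 5040] :: real list"
      show "(t - (-1/15)) * (t - 1/5) * ((t + 3/5)\<^sup>2 * (t + 1/3)\<^sup>2) * (t - 7/15) =
          (\<Sum>k\<le>7. ?c ! k * gegenbauer CARD('n) k t)" for t :: real
        by (simp add: n atMost_nat_numeral gegenbauer_23) (simp add: field_simps eval_nat_numeral)
      show "(t - (-1/15)) * (t - 1/5) * ((t + 3/5)\<^sup>2 * (t + 1/3)\<^sup>2) * (t - 7/15) \<le> 0"
        if "t \<le> 7/15" "t \<notin> T" for t
        using that by (intro sgn) (auto simp: 3)
    qed (auto simp: power2_eq_square nth_Cons')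
  qed
qed

text \<open>The cubic is positive between -1/3 and -1/15, so the discrete set of inner products
  matters and not only the maximum 1/5. Its bound is f(1)/c_0 = 2944/11, just below 268.\<close>

lemma card_lt_if_le_1_5:
  fixes C :: "(real ^ 'n::finite) set"
  assumes n: "CARD('n) = 23" and C: "spherical_code C"
    and ip: "\<And>x y. x \<in> C \<Longrightarrow> y \<in> C \<Longrightarrow> x \<noteq> y \<Longrightarrow> x \<bullet> y \<in> {-3/5, -1/3, -1/15, 1/5}"
  shows "card C < 268"
proof -
  define f where "f t = (t + 1/3) * (t + 1/15) * (t - 1/5)" for t :: real
  let ?c = "[22/5175, 14/225, 2/5, 6] :: real list"
  have "?c ! 0 * real (card C) \<le> f 1"
  proof (rule linear_programming_bound[OF C])
    show "f t = (\<Sum>k\<le>3. ?c ! k * gegenbauer CARD('n) k t)" for t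
      by (simp add: f_def n atMost_nat_numeral gegenbauer_23) (simp add: field_simps eval_nat_numeral)
    show "?c ! k \<ge> 0" if "k \<le> 3" for k
      using that by (auto simp: nth_Cons')
    show "f (x \<bullet> y) \<le> 0" if "x \<in> C" "y \<in> C" "x \<noteq> y" for x y
    proof -
      have "f t \<le> 0" if "t \<in> {-3/5, -1/3, -1/15, 1/5}" for t
        using that by (elim insertE emptyE; hypsubst; simp add: f_def)
      with ip[OF that] show ?thesis by blast
    qed
  qed (simp add: f_def)
  then show ?thesis
    by (simp add: f_def)
qed

text \<open>
  With \<open>f t = t\<^sup>2 (t\<^sup>2 - 1/16) (t\<^sup>2 - 1/4)\<close> the bound is attained, so the Gegenbauer sums of degrees
  2 and 4 vanish and determine the distribution of inner products from any point of the code.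
\<close>

lemma card_neighbours:
  fixes L :: "(real ^ 'n::finite) set"
  assumes n: "CARD('n) = 24" and L: "spherical_code L" and card: "card L \<ge> 196560"
    and ip: "\<And>x y. x \<in> L \<Longrightarrow> y \<in> L \<Longrightarrow> x \<bullet> y \<in> {1, -1, 1/2, -1/2, 1/4, -1/4, 0}"
    and minus: "\<And>x. x \<in> L \<Longrightarrow> - x \<in> L"
    and x: "x \<in> L"
  shows "card {y \<in> L. x \<bullet> y = 1/4} = 47104"
proof -
  have fin: "finite L" and sph: "L \<subseteq> sphere 0 1"
    using L by (auto simp: spherical_code_def)
  have norm: "norm y = 1" if "y \<in> L" for y
    using that sph by auto
  have ip_1: "z = y" if "y \<in> L" "z \<in> L" "y \<bullet> z = 1" for y z
    using that norm by (metis norm_cauchy_schwarz_eq mult_1 scaleR_one)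
  have ip_m1: "z = - y" if "y \<in> L" "z \<in> L" "y \<bullet> z = -1" for y z
    using ip_1[of "- y" z] that minus by simp
  have ends: "(\<Sum>z\<in>L. if y \<bullet> z = 1 \<or> y \<bullet> z = -1 then c else 0) = 2 * c" if y: "y \<in> L" for y and c :: real
  proof -
    have "y \<bullet> y = 1"
      using norm[OF y] by (simp add: norm_eq_1)
    then have "{y, - y} \<subseteq> {z \<in> L. y \<bullet> z = 1 \<or> y \<bullet> z = -1}"
      using y minus[OF y] by simp
    moreover have "{z \<in> L. y \<bullet> z = 1 \<or> y \<bullet> z = -1} \<subseteq> {y, - y}"
      using ip_1[OF y] ip_m1[OF y] by blast
    ultimately have eq: "{z \<in> L. y \<bullet> z = 1 \<or> y \<bullet> z = -1} = {y, - y}"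
      by blast
    have "y \<noteq> - y"
    proof
      assume "y = - y"
      then have "y \<bullet> y = y \<bullet> (- y)"
        by (rule arg_cong)
      then show False
        using \<open>y \<bullet> y = 1\<close> by simp
    qed
    then have "card {z \<in> L. y \<bullet> z = 1 \<or> y \<bullet> z = -1} = 2"
      unfolding eq by (rule card_2_iff[THEN iffD2, OF exI, OF exI, OF conjI[OF refl]])
    then show ?thesis
      using fin by (simp add: sum.If_cases Int_def)
  qed
  define S where "S k = (\<Sum>y\<in>L. \<Sum>z\<in>L. gegenbauer CARD('n) k (y \<bullet> z))" for k
  have S: "S k \<ge> 0" for k
    unfolding S_def by (rule gegenbauer_sum_nonneg[OF sph])
  have S0: "S 0 = (real (card L))\<^sup>2"
    by (simp add: S_def power2_eq_square)
  \<comment> \<open>The inner products are a known finite set, so zeros at those other than 1 and -1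
    replace any sign condition.\<close>
  define f where "f t = t\<^sup>2 * (t\<^sup>2 - 1/16) * (t\<^sup>2 - 1/4)" for t :: real
  let ?c = "[1/139776, 0, 1/224, 0, 15/4, 0, 720] :: real list"
  have f: "f t = (\<Sum>k\<le>6. ?c ! k * gegenbauer CARD('n) k t)" for t
    by (simp add: f_def n atMost_nat_numeral gegenbauer_24) (simp add: field_simps eval_nat_numeral)
  have "(\<Sum>y\<in>L. \<Sum>z\<in>L. f (y \<bullet> z)) = 1/139776 * S 0 + 1/224 * S 2 + 15/4 * S 4 + 720 * S 6"
    using sum_gegenbauer_expansion[OF f, of L L] by (simp add: S_def atMost_nat_numeral)
  moreover have "(\<Sum>y\<in>L. \<Sum>z\<in>L. f (y \<bullet> z)) = (\<Sum>y\<in>L. \<Sum>z\<in>L. if y \<bullet> z = 1 \<or> y \<bullet> z = -1 then 45/64 else 0)"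
  proof (intro sum.cong refl)
    fix y z assume "y \<in> L" "z \<in> L"
    have "f t = (if t = 1 \<or> t = -1 then 45/64 else 0)" if "t \<in> {1, -1, 1/2, -1/2, 1/4, -1/4, 0}" for t
      using that by (elim insertE emptyE; hypsubst; simp add: f_def power2_eq_square)
    with ip[OF \<open>y \<in> L\<close> \<open>z \<in> L\<close>] show "f (y \<bullet> z) = (if y \<bullet> z = 1 \<or> y \<bullet> z = -1 then 45/64 else 0)"
      by blast
  qed
  moreover have "\<dots> = real (card L) * (45/32)"
    by (simp add: ends)
  ultimately have total: "1/224 * S 2 + 15/4 * S 4 + 720 * S 6 = real (card L) * (196560 - real (card L)) / 139776"
    unfolding S0 by (simp add: field_simps power2_eq_square)
  have "real (card L) * (196560 - real (card L)) \<le> 0"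
    using card by (intro mult_nonneg_nonpos) auto
  \<comment> \<open>A nonnegative combination equals a nonpositive number, so both are zero.\<close>
  then have "S 2 = 0" "S 4 = 0" and zero: "real (card L) * (196560 - real (card L)) = 0"
    using total S[of 2] S[of 4] S[of 6] by linarith+
  have N: "real (card L) = 196560"
    using zero card by auto
  \<comment> \<open>Zeros at 0, 1/2 and -1/2 leave only the unknown count at 1/4 and -1/4; degree 4
    needs only the vanishing sums of degrees 2 and 4.\<close>
  define g where "g t = t\<^sup>2 * (t\<^sup>2 - 1/4)" for t :: real
  let ?d = "[-7/1248, 0, -1/14, 0, 24] :: real list"
  have g: "g t = (\<Sum>k\<le>4. ?d ! k * gegenbauer CARD('n) k t)" for t
    by (simp add: g_def n atMost_nat_numeral gegenbauer_24) (simp add: field_simps eval_nat_numeral)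
  have "(\<Sum>z\<in>L. gegenbauer CARD('n) k (x \<bullet> z)) = 0" if "S k = 0" for k
    using gegenbauer_sum_eq_0[OF sph norm[OF x]] that unfolding S_def .
  then have "(\<Sum>z\<in>L. g (x \<bullet> z)) = -7/1248 * 196560"
    using sum_gegenbauer_expansion[OF g, of "{x}" L] \<open>S 2 = 0\<close> \<open>S 4 = 0\<close>
    by (simp add: atMost_nat_numeral N inner_commute[of x])
  moreover have "g (x \<bullet> z) = (if x \<bullet> z = 1 \<or> x \<bullet> z = -1 then 3/4 else 0)
      + ((if x \<bullet> z = 1/4 then -3/256 else 0) + (if x \<bullet> z = -1/4 then -3/256 else 0))" if "z \<in> L" for z
  proof -
    have "g t = (if t = 1 \<or> t = -1 then 3/4 else 0)
        + ((if t = 1/4 then -3/256 else 0) + (if t = -1/4 then -3/256 else 0))"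
      if "t \<in> {1, -1, 1/2, -1/2, 1/4, -1/4, 0}" for t
      using that by (elim insertE emptyE; hypsubst; simp add: g_def power2_eq_square)
    with ip[OF x that] show ?thesis
      by blast
  qed
  moreover have "(\<Sum>z\<in>L. if P z then c else 0) = real (card {z \<in> L. P z}) * c" for P and c :: real
    using fin by (simp add: sum.If_cases Int_def)
  ultimately have "-7/1248 * 196560 = 3/2 - 3/256 * real (card {z \<in> L. x \<bullet> z = 1/4})
      - 3/256 * real (card {z \<in> L. x \<bullet> z = -1/4})"
    using ends[OF x, of "3/4"] by (simp add: sum.distrib)
  moreover have "card {z \<in> L. x \<bullet> z = -1/4} = card {z \<in> L. x \<bullet> z = 1/4}"
  proof -
    have "bij_betw uminus {z \<in> L. x \<bullet> z = 1/4} {z \<in> L. x \<bullet> z = -1/4}"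
      by (rule bij_betw_byWitness[of _ uminus]) (auto intro: minus)
    then show ?thesis
      by (rule bij_betw_same_card[symmetric])
  qed
  ultimately have "real (card {z \<in> L. x \<bullet> z = 1/4}) = 47104"
    by simp
  then show ?thesis
    by linarith
qed

section \<open>The extended Golay code\<close>

lemma of_int_23_eq_iff: "(of_int x :: 23) = of_int y \<longleftrightarrow> x mod 23 = y mod 23"
proof
  assume "(of_int x :: 23) = of_int y"
  then have "Rep_bit1 (of_int x :: 23) = Rep_bit1 (of_int y :: 23)"
    by simp
  \<comment> \<open>The numeral type 23 is \<open>11 bit1\<close>, as 23 = 2 * 11 + 1; hence the
    instance at 11.\<close>
  then show "x mod 23 = y mod 23"
    using bit1.Rep_Abs_mod[where 'a = 11, of x] bit1.Rep_Abs_mod[where 'a = 11, of y]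
    by (simp add: bit1.of_int_eq)
qed (simp add: bit1.of_int_eq)

definition nonresidues :: "int list" where
  "nonresidues = [5, 7, 10, 11, 14, 15, 17, 19, 20, 21, 22]"

lemma nonresidues_iff: "r \<in> {0..22} \<Longrightarrow> r \<in> set nonresidues \<longleftrightarrow> (\<forall>j\<in>{0..22}. j * j mod 23 \<noteq> r)"
proof -
  have "list_all (\<lambda>r. r \<in> set nonresidues \<longleftrightarrow> list_all (\<lambda>j. j * j mod 23 \<noteq> r) [0..22]) [0..22]"
    by code_simp
  then show "r \<in> {0..22} \<Longrightarrow> ?thesis"
    by (simp only: list_all_iff set_upto)
qed

text \<open>The integers 0 to 23 name the points, 23 being infinity, so that incidence can be
  decided by evaluation on lists of integers.\<close>

definition point :: "int \<Rightarrow> 23 option" where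
  "point i = (if i = 23 then None else Some (of_int i))"

definition gen_mem :: "int \<Rightarrow> int \<Rightarrow> bool" where
  "gen_mem a i \<longleftrightarrow> i = 23 \<or> (i - a) mod 23 \<in> set nonresidues"

lemma nonsquare_iff: "(\<nexists>t::23. of_int m = t * t) \<longleftrightarrow> m mod 23 \<in> set nonresidues"
proof -
  have "(\<exists>t::23. of_int m = t * t) \<longleftrightarrow> (\<exists>j\<in>{0..22}. j * j mod 23 = m mod 23)"
  proof
    assume "\<exists>t::23. of_int m = t * t"
    then obtain t :: 23 where t: "of_int m = t * t" ..
    obtain j where j: "t = of_int j" "0 \<le> j" "j < 23"
      by (rule bit1_cases[of t]) simp
    with t have "(of_int m :: 23) = of_int (j * j)"
      by simp
    then have "m mod 23 = j * j mod 23"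
      unfolding of_int_23_eq_iff .
    with j show "\<exists>j\<in>{0..22}. j * j mod 23 = m mod 23"
      by (intro bexI[of _ j]) auto
  next
    assume "\<exists>j\<in>{0..22}. j * j mod 23 = m mod 23"
    then obtain j where "j * j mod 23 = m mod 23" by blast
    then have "(of_int (j * j) :: 23) = of_int m"
      unfolding of_int_23_eq_iff .
    then show "\<exists>t::23. of_int m = t * t"
      by (intro exI[of _ "of_int j"]) simp
  qed
  then show ?thesis
    using nonresidues_iff[of "m mod 23"] by (auto simp: pos_mod_bound zle_diff1_eq[symmetric] simp del: zle_diff1_eq)
qed

lemma point_mem_golay_gen: "point i \<in> golay_gen (of_int a) \<longleftrightarrow> gen_mem a i"
proof (cases "i = 23")
  case False
  have "Some (of_int i) \<in> golay_gen (of_int a) \<longleftrightarrow> (\<exists>n::23. of_int i = n + of_int a \<and> (\<nexists>t. n = t * t))"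
    by (auto simp: golay_gen_def)
  also have "\<dots> \<longleftrightarrow> (\<nexists>t::23. of_int (i - a) = t * t)"
  proof -
    have "of_int i = n + of_int a \<longleftrightarrow> n = of_int (i - a)" for n :: 23
      by (auto simp: algebra_simps)
    then show ?thesis
      by simp
  qed
  also have "\<dots> \<longleftrightarrow> gen_mem a i"
    using False by (simp only: nonsquare_iff) (simp add: gen_mem_def)
  finally show ?thesis
    using False by (simp add: point_def)
qed (simp add: point_def gen_mem_def golay_gen_def)

lemma range_point: "x \<in> point ` {0..23}"
proof (cases x)
  case None
  then show ?thesis by (intro image_eqI[of _ _ 23]) (auto simp: point_def)
next
  case (Some t)
  obtain j where "t = of_int j" "0 \<le> j" "j < 23"
    by (rule bit1_cases[of t]) simp
  with Some show ?thesis by (intro image_eqI[of _ _ j]) (auto simp: point_def)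
qed

lemma eq_image_point: "S = point ` {i \<in> {0..23}. point i \<in> S}"
  using range_point by fast

lemma inj_point: "inj_on point {0..23}"
  by (auto simp: inj_on_def point_def of_int_23_eq_iff split: if_splits)

lemma ex_of_int_23: "\<exists>x\<in>{0..22}. (a :: 23) = of_int x"
  by (rule bit1_cases[of a]) (auto intro!: bexI)

fun parity :: "bool list \<Rightarrow> bool" where
  "parity [] = False"
| "parity (b # bs) = (b \<noteq> parity bs)"

lemma parity_map: "distinct xs \<Longrightarrow> parity (map P xs) \<longleftrightarrow> odd (card {x \<in> set xs. P x})"
proof (induction xs)
  case (Cons x xs)
  have "{y \<in> set (x # xs). P y} = (if P x then insert x {y \<in> set xs. P y} else {y \<in> set xs. P y})"
    by auto
  then show ?case
    using Cons by auto
qed simp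

text \<open>Orthogonality of the generators, evaluated for all pairs; together with their weight 12
  it makes the whole code doubly even.\<close>

lemma even_card_gen_Int_gen: "even (card (golay_gen a \<inter> golay_gen b))"
proof -
  obtain x y where xy: "x \<in> {0..22}" "a = of_int x" "y \<in> {0..22}" "b = of_int y"
    using ex_of_int_23 by metis
  have "list_all (\<lambda>u. list_all (\<lambda>v. \<not> parity (map2 (\<and>) u v)) (map (\<lambda>a. map (gen_mem a) [0..23]) [0..22]))
      (map (\<lambda>a. map (gen_mem a) [0..23]) [0..22])"
    by code_simp
  then have "\<not> parity (map2 (\<and>) (map (gen_mem x) [0..23]) (map (gen_mem y) [0..23]))"
    using xy by (simp only: list_all_iff set_map set_upto) blast
  then have "\<not> parity (map (\<lambda>i. gen_mem x i \<and> gen_mem y i) [0..23])"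
    by (simp only: map2_map_map not_False_eq_True)
  then have "even (card {i \<in> {0..23}. gen_mem x i \<and> gen_mem y i})"
    using parity_map[of "[0..23]" "\<lambda>i. gen_mem x i \<and> gen_mem y i"] by simp
  moreover have "golay_gen a \<inter> golay_gen b = point ` {i \<in> {0..23}. gen_mem x i \<and> gen_mem y i}"
    using eq_image_point[of "golay_gen a \<inter> golay_gen b"] by (simp add: xy point_mem_golay_gen)
  moreover have "inj_on point {i \<in> {0..23}. gen_mem x i \<and> gen_mem y i}"
    using inj_point by (rule inj_on_subset) auto
  ultimately show ?thesis
    by (simp add: card_image)
qed

lemma card_golay_gen: "card (golay_gen a) = 12"
proof -
  obtain x where x: "x \<in> {0..22}" "a = of_int x"
    using ex_of_int_23 by metis
  have "list_all (\<lambda>x. length (filter (gen_mem x) [0..23]) = 12) [0..22]"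
    by code_simp
  then have "length (filter (gen_mem x) [0..23]) = 12"
    using x by (simp only: list_all_iff set_upto)
  then have "card {i \<in> {0..23}. gen_mem x i} = 12"
    using distinct_card[of "filter (gen_mem x) [0..23]"] by (simp add: Int_def Collect_conj_eq[symmetric] conj_commute)
  moreover have "golay_gen a = point ` {i \<in> {0..23}. gen_mem x i}"
    using eq_image_point[of "golay_gen a"] by (simp add: x point_mem_golay_gen)
  moreover have "inj_on point {i \<in> {0..23}. gen_mem x i}"
    using inj_point by (rule inj_on_subset) auto
  ultimately show ?thesis
    by (simp add: card_image)
qed

fun pairs :: "'a list \<Rightarrow> ('a \<times> 'a) list" where
  "pairs [] = []"
| "pairs (x # xs) = map (Pair x) xs @ pairs xs"

lemma nth_pair_in_pairs: "i < j \<Longrightarrow> j < length xs \<Longrightarrow> (xs ! i, xs ! j) \<in> set (pairs xs)"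
proof (induction xs arbitrary: i j)
  case (Cons x xs)
  then show ?case
    by (cases i; cases j) auto
qed simp

text \<open>
  A radix partition: it decides distinctness of long lists of bit strings with far fewer
  comparisons than a comparison of all pairs.
\<close>

fun separated :: "nat \<Rightarrow> bool list list \<Rightarrow> bool" where
  "separated 0 us = (case us of [] \<Rightarrow> True | u # us' \<Rightarrow> us' = [])"
| "separated (Suc n) us = (case us of [] \<Rightarrow> True | u # us' \<Rightarrow> us' = [] \<or>
    separated n (map tl (filter hd us)) \<and> separated n (map tl (filter (\<lambda>u. \<not> hd u) us)))"

lemma distinct_if_distinct_filters:
  "distinct (filter P xs) \<Longrightarrow> distinct (filter (\<lambda>x. \<not> P x) xs) \<Longrightarrow> distinct xs"
  by (induction xs) (auto split: if_splits)

lemma separated_imp_distinct: "separated n us \<Longrightarrow> distinct us"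
proof (induction n arbitrary: us)
  case 0
  then show ?case by (auto split: list.splits)
next
  case (Suc n)
  show ?case
  proof (cases "length us \<le> 1")
    case True
    then show ?thesis by (cases us) auto
  next
    case False
    then have "separated n (map tl (filter hd us))" "separated n (map tl (filter (\<lambda>u. \<not> hd u) us))"
      using Suc.prems by (auto split: list.splits)
    then have "distinct (filter hd us)" "distinct (filter (\<lambda>u. \<not> hd u) us)"
      by (auto dest!: Suc.IH simp: distinct_map)
    then show ?thesis
      by (rule distinct_if_distinct_filters)
  qed
qed

text \<open>The column of point \<open>i\<close> in the matrix of generators. Since the code is
  self-orthogonal, the generators double as parity checks.\<close>

definition syndrome :: "int \<Rightarrow> bool list" where
  "syndrome i = map (\<lambda>a. gen_mem a i) [0..22]"

lemma distinct_pair_syndromes: "distinct (map (\<lambda>(u, v). map2 (\<noteq>) u v) (pairs (map syndrome [0..23])))"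
proof (rule separated_imp_distinct)
  \<comment> \<open>There are 276 sums of two columns, each of 23 bits, whence the depth 23.\<close>
  show "separated 23 (map (\<lambda>(u, v). map2 (\<noteq>) u v) (pairs (map syndrome [0..23])))"
    by code_simp
qed

lemma distinct_syndromes: "distinct (map syndrome [0..23])"
proof (rule separated_imp_distinct)
  show "separated 23 (map syndrome [0..23])"
    by code_simp
qed

section \<open>Self-orthogonality and weights\<close>

lemma sym_diff_mem_golay:
  assumes "c \<in> golay_code" "d \<in> golay_code"
  shows "sym_diff c d \<in> golay_code"
  using assms(2)
proof induction
  case zero
  then show ?case
    using assms(1) by simp
next
  case (add_all d)
  have "sym_diff c (sym_diff d UNIV) = sym_diff (sym_diff c d) UNIV"
    by auto
  with add_all show ?case
    by (metis golay_code.add_all)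
next
  case (add_gen d a)
  have "sym_diff c (sym_diff d (golay_gen a)) = sym_diff (sym_diff c d) (golay_gen a)"
    by auto
  with add_gen show ?case
    by (metis golay_code.add_gen)
qed

lemma golay_gen_mem_golay: "golay_gen a \<in> golay_code"
  using golay_code.add_gen[OF golay_code.zero, of a] by simp

lemma Compl_mem_golay: "c \<in> golay_code \<Longrightarrow> - c \<in> golay_code"
  using golay_code.add_all[of c] by (simp add: Compl_eq_Diff_UNIV)

lemma card_sym_diff:
  assumes "finite A" "finite B"
  shows "card (sym_diff A B) + 2 * card (A \<inter> B) = card A + card B"
proof -
  have "card (sym_diff A B) = card (A - B) + card (B - A)"
    using assms by (intro card_Un_disjoint) auto
  moreover have "card A = card (A - B) + card (A \<inter> B)" "card B = card (B - A) + card (A \<inter> B)"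
    using assms by (simp_all add: card_Diff_subset_Int Int_commute card_mono)
  ultimately show ?thesis by simp
qed

text \<open>Adding a generator g turns the weight into |c| + 12 - 2 |c \<inter> g|, so divisibility
  by 4 survives only if the intersections are even. Both properties therefore pass through one
  induction.\<close>

lemma golay_doubly_even_aux:
  assumes "c \<in> golay_code"
  shows "4 dvd card c \<and> (\<forall>a. even (card (c \<inter> golay_gen a)))"
  using assms
proof induction
  case (add_all c)
  have "card (sym_diff c UNIV) + 2 * card c = card c + 24"
    using card_sym_diff[of c UNIV] by simp
  have "card (sym_diff c UNIV \<inter> golay_gen a) + card (c \<inter> golay_gen a) = 12" for a
  proof -
    have "card (sym_diff c UNIV \<inter> golay_gen a \<union> c \<inter> golay_gen a) =
        card (sym_diff c UNIV \<inter> golay_gen a) + card (c \<inter> golay_gen a)"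
      by (rule card_Un_disjoint) auto
    moreover have "sym_diff c UNIV \<inter> golay_gen a \<union> c \<inter> golay_gen a = golay_gen a"
      by auto
    ultimately show ?thesis
      by (simp add: card_golay_gen)
  qed
  then have "even (card (sym_diff c UNIV \<inter> golay_gen a))" for a
    using add_all by (metis even_add even_numeral)
  moreover have "4 dvd card (sym_diff c UNIV)"
  proof -
    obtain k where "card c = 4 * k"
      using add_all by blast
    then have "card (sym_diff c UNIV) + 4 * k = 24"
      using \<open>card (sym_diff c UNIV) + 2 * card c = card c + 24\<close> by simp
    then show ?thesis
      by presburger
  qed
  ultimately show ?case
    by blast
next
  case (add_gen c b)
  have "even (card (sym_diff c (golay_gen b) \<inter> golay_gen a))" for a
  proof -
    have "sym_diff c (golay_gen b) \<inter> golay_gen a = sym_diff (c \<inter> golay_gen a) (golay_gen b \<inter> golay_gen a)"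
      by auto
    then have "card (sym_diff c (golay_gen b) \<inter> golay_gen a) +
        2 * card ((c \<inter> golay_gen a) \<inter> (golay_gen b \<inter> golay_gen a)) = card (c \<inter> golay_gen a) + card (golay_gen b \<inter> golay_gen a)"
      using card_sym_diff[of "c \<inter> golay_gen a" "golay_gen b \<inter> golay_gen a"] by simp
    moreover have "even (card (c \<inter> golay_gen a))"
      using add_gen by blast
    ultimately show ?thesis
      using even_card_gen_Int_gen[of b a] by presburger
  qed
  moreover have "4 dvd card (sym_diff c (golay_gen b))"
  proof -
    obtain k l where "card (c \<inter> golay_gen b) = 2 * k" "card c = 4 * l"
      using add_gen by (meson evenE dvdE)
    then have "card (sym_diff c (golay_gen b)) + 4 * k = 4 * l + 12"
      using card_sym_diff[of c "golay_gen b"] by (simp add: card_golay_gen)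
    then show ?thesis
      by presburger
  qed
  ultimately show ?case
    by blast
qed simp

lemma dvd_card_golay: "c \<in> golay_code \<Longrightarrow> 4 dvd card c"
  using golay_doubly_even_aux by blast

lemma even_card_Int_golay:
  assumes "c \<in> golay_code" "d \<in> golay_code"
  shows "even (card (c \<inter> d))"
  using card_sym_diff[of c d] dvd_card_golay[OF assms(1)] dvd_card_golay[OF assms(2)]
    dvd_card_golay[OF sym_diff_mem_golay[OF assms]] by simp presburger

text \<open>
  A word of weight 4 would be orthogonal to all generators, so that two disjoint pairs of points
  would have the same sum of syndromes.
\<close>

lemma card_golay_ne_4:
  assumes c: "c \<in> golay_code"
  shows "card c \<noteq> 4"
proof
  assume "card c = 4"
  define I where "I = {i \<in> {0..23}. point i \<in> c}"
  have cI: "c = point ` I"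
    unfolding I_def by (rule eq_image_point)
  have inj: "inj_on point I"
    using inj_point by (rule inj_on_subset) (auto simp: I_def)
  have "card I = 4"
    using \<open>card c = 4\<close> card_image[OF inj] by (simp add: cI)
  moreover have "finite I"
    unfolding I_def by (rule finite_subset[of _ "{0..23}"]) auto
  ultimately obtain xs where xs: "set xs = I" "sorted xs" "distinct xs" "length xs = 4"
    by (metis finite_distinct_list distinct_card sorted_list_of_set)
  then obtain p q r s where pqrs: "xs = [p, q, r, s]"
    by (auto simp: length_Suc_conv numeral_eq_Suc)
  \<comment> \<open>Sorting splits the support into the pairs p < q and r < s, oriented as
    \<open>pairs\<close> lists them.\<close>
  have I: "I = {p, q, r, s}" and ord: "p < q" "q < r" "r < s"
    using xs by (auto simp: pqrs)
  then have bounds: "0 \<le> p" "s \<le> 23"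
    by (auto simp: I_def)
  have par: "(gen_mem a p \<noteq> gen_mem a q) = (gen_mem a r \<noteq> gen_mem a s)" for a
  proof -
    have "c \<inter> golay_gen (of_int a) = point ` {i \<in> I. gen_mem a i}"
      by (auto simp: cI point_mem_golay_gen)
    moreover have "inj_on point {i \<in> I. gen_mem a i}"
      using inj by (rule inj_on_subset) auto
    ultimately have "even (card {i \<in> set [p, q, r, s]. gen_mem a i})"
      using golay_doubly_even_aux[OF c] by (metis I card_image empty_set list.simps(15))
    then have "\<not> parity (map (gen_mem a) [p, q, r, s])"
      using xs(3) parity_map[of "[p, q, r, s]" "gen_mem a"] by (simp only: pqrs) simp
    then show ?thesis by auto
  qed
  let ?us = "map syndrome [0..23]"
  have syn: "?us ! nat i = syndrome i" if "0 \<le> i" "i \<le> 23" for i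
    using that by (simp add: nth_upto)
  have pair: "(syndrome i, syndrome j) \<in> set (pairs ?us)" if "0 \<le> i" "i < j" "j \<le> 23" for i j
    using nth_pair_in_pairs[of "nat i" "nat j" ?us] that by (simp add: syn nat_less_eq_zless nat_less_iff del: upto_rec_numeral)
  have "map2 (\<noteq>) (syndrome p) (syndrome q) = map2 (\<noteq>) (syndrome r) (syndrome s)"
    using par by (simp only: syndrome_def map2_map_map)
  moreover have "inj_on (\<lambda>(u, v). map2 (\<noteq>) u v) (set (pairs ?us))"
    using distinct_pair_syndromes by (simp only: distinct_map)
  ultimately have "(syndrome p, syndrome q) = (syndrome r, syndrome s)"
    using pair[of p q] pair[of r s] ord bounds by (elim inj_onD) simp_all
  then have "syndrome p = syndrome r"
    by simp
  moreover have "p \<in> set [0..23]" "r \<in> set [0..23]"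
    using ord bounds by auto
  ultimately show False
    using distinct_syndromes ord by (simp only: distinct_map) (auto dest: inj_onD)
qed

text \<open>Weight 20 is excluded along with 4, by passing to the complement.\<close>

lemma card_golay:
  assumes "c \<in> golay_code"
  shows "card c \<in> {0, 8, 12, 16, 24}"
proof -
  have "card (- c) = 24 - card c" "card c \<le> 24"
    using card_mono[of UNIV c] by (simp_all add: Compl_eq_Diff_UNIV card_Diff_subset)
  moreover have "card c \<noteq> 4" "card (- c) \<noteq> 4"
    using assms by (simp_all add: card_golay_ne_4 Compl_mem_golay)
  moreover obtain k where "card c = 4 * k"
    using dvd_card_golay[OF assms] by blast
  ultimately have "k \<le> 6" "k \<noteq> 1" "k \<noteq> 5" "card c = 4 * k"
    by auto
  then have "k = 0 \<or> k = 2 \<or> k = 3 \<or> k = 4 \<or> k = 6"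
    by linarith
  with \<open>card c = 4 * k\<close> show ?thesis
    by auto
qed

section \<open>Size of the code and number of octads\<close>

lemma golay_separates:
  assumes "x \<noteq> y"
  obtains c where "c \<in> golay_code" "(x \<in> c) \<noteq> (y \<in> c)"
proof -
  obtain i j where ij: "i \<in> {0..23}" "x = point i" "j \<in> {0..23}" "y = point j"
    using range_point by blast
  then have "syndrome i \<noteq> syndrome j"
    using distinct_syndromes assms by (simp only: distinct_map set_upto) (auto dest: inj_onD)
  then obtain a where "gen_mem a i \<noteq> gen_mem a j"
    by (auto simp: syndrome_def)
  then show ?thesis
    using that[of "golay_gen (of_int a)"] golay_gen_mem_golay by (simp add: ij point_mem_golay_gen)
qed

text \<open>
  The point at infinity together with the translate by \<open>j\<close> of \<open>{0, 2, 4, 5, 6, 10, 11}\<close>, the support of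
  the generator polynomial of the cyclic Golay code; its last finite point is \<open>j + 11\<close>.
\<close>

definition low_word :: "int \<Rightarrow> 23 option set" where
  "low_word j = sym_diff (golay_gen (of_int j)) (sym_diff (golay_gen (of_int (j + 1))) (golay_gen (of_int (j + 20))))"

lemma low_word_mem_golay: "low_word j \<in> golay_code"
  unfolding low_word_def by (intro sym_diff_mem_golay golay_gen_mem_golay)

text \<open>Echelon form of the twelve words, with leading position j + 11.\<close>

lemma point_mem_low_word:
  assumes "j \<in> {0..11}" "i \<in> {j + 11..22}"
  shows "point i \<in> low_word j \<longleftrightarrow> i = j + 11"
proof -
  have "list_all (\<lambda>j. list_all (\<lambda>i. (gen_mem j i \<noteq> (gen_mem (j + 1) i \<noteq> gen_mem (j + 20) i)) = (i = j + 11)) [j + 11..22]) [0..11]"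
    by code_simp
  then have "(gen_mem j i \<noteq> (gen_mem (j + 1) i \<noteq> gen_mem (j + 20) i)) = (i = j + 11)"
    using assms by (simp only: list_all_iff set_upto)
  moreover have "point i \<in> low_word j \<longleftrightarrow> (gen_mem j i \<noteq> (gen_mem (j + 1) i \<noteq> gen_mem (j + 20) i))"
    unfolding low_word_def by (simp only: Un_iff Diff_iff point_mem_golay_gen) blast
  ultimately show ?thesis
    by blast
qed

text \<open>Adding \<open>low_word m\<close> to a word of \<open>F m\<close> puts in the point m +
  11, so the sum leaves \<open>F m\<close> but stays in \<open>F (Suc m)\<close>. Each of the 12
  steps doubles the count.\<close>

lemma card_golay_code_ge: "card golay_code \<ge> 4096"
proof -
  define F where "F m = {c \<in> golay_code. \<forall>i\<in>{int m + 11..22}. point i \<notin> c}" for m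
  have fin: "finite (F m)" for m
    by (simp add: F_def)
  have "2 ^ m \<le> card (F m)" if "m \<le> 12" for m
    using that
  proof (induction m)
    case 0
    have "{} \<in> F 0"
      by (simp add: F_def golay_code.zero)
    then show ?case
      using fin by (metis One_nat_def Suc_leI card_gt_0_iff empty_iff power_0)
  next
    case (Suc m)
    let ?h = "\<lambda>c. sym_diff c (low_word m)"
    have m: "int m \<in> {0..11}"
      using Suc.prems by simp
    have w: "point i \<in> low_word m \<longleftrightarrow> i = int m + 11" if "i \<in> {int m + 11..22}" for i
      using point_mem_low_word[OF m that] .
    have top: "int m + 11 \<in> {int m + 11..22}"
      using m by auto
    have "?h (?h c) = c" for c
      by auto
    then have "inj_on ?h (F m)"
      by (rule inj_on_inverseI[where g = ?h])
    then have "card (?h ` F m) = card (F m)"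
      by (rule card_image)
    moreover have "point (int m + 11) \<in> d" if "d \<in> ?h ` F m" for d
      using that w[OF top] top by (auto simp: F_def)
    then have "F m \<inter> ?h ` F m = {}"
      using top unfolding F_def by blast
    then have "card (F m \<union> ?h ` F m) = card (F m) + card (?h ` F m)"
      using fin by (intro card_Un_disjoint) auto
    moreover have "F m \<union> ?h ` F m \<subseteq> F (Suc m)"
    proof (intro Un_least subsetI)
      fix d
      assume "d \<in> ?h ` F m"
      then obtain c where c: "c \<in> F m" "d = ?h c"
        by blast
      have "point i \<notin> d" if "i \<in> {int (Suc m) + 11..22}" for i
        using that w[of i] c by (auto simp: F_def)
      moreover have "d \<in> golay_code"
        unfolding c(2) using c(1) by (intro sym_diff_mem_golay low_word_mem_golay) (simp add: F_def)
      ultimately show "d \<in> F (Suc m)"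
        by (simp add: F_def)
    next
      fix c
      assume "c \<in> F m"
      then show "c \<in> F (Suc m)"
        by (simp add: F_def)
    qed
    then have "card (F m \<union> ?h ` F m) \<le> card (F (Suc m))"
      using fin by (intro card_mono)
    ultimately show ?case
      using Suc by simp
  qed
  from this[of 12] have "4096 \<le> card (F 12)"
    by simp
  also have "\<dots> \<le> card golay_code"
    by (rule card_mono) (auto simp: F_def)
  finally show ?thesis .
qed

text \<open>Translation by a codeword that contains exactly one of \<open>x\<close> and
  \<open>y\<close> flips the sign of every summand.\<close>

lemma sum_sign_products_eq_0:
  assumes "x \<noteq> y"
  shows "(\<Sum>c\<in>golay_code. (1 - 2 * of_bool (x \<in> c)) * (1 - 2 * of_bool (y \<in> c)) :: int) = 0"
proof -
  obtain d where d: "d \<in> golay_code" "(x \<in> d) \<noteq> (y \<in> d)"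
    using golay_separates[OF assms] .
  let ?h = "\<lambda>c. (1 - 2 * of_bool (x \<in> c)) * (1 - 2 * of_bool (y \<in> c)) :: int"
  have "(\<Sum>c\<in>golay_code. ?h c) = (\<Sum>c\<in>golay_code. ?h (sym_diff c d))"
    by (rule sum.reindex_bij_witness[of _ "\<lambda>c. sym_diff c d" "\<lambda>c. sym_diff c d"])
      (use d(1) sym_diff_mem_golay in \<open>auto intro: arg_cong[where f = ?h]\<close>)
  also have "\<dots> = (\<Sum>c\<in>golay_code. - ?h c)"
    by (rule sum.cong) (use d(2) in auto)
  finally show ?thesis
    by (simp add: sum_negf)
qed

lemma sum_of_bool_mem: "(\<Sum>i\<in>UNIV. of_bool (i \<in> c)) = int (card c)" for c :: "'n::finite set"
  by (simp add: of_bool_def sum.If_cases)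

text \<open>
  The second moment of \<open>24 - 2 |c|\<close> over the code is \<open>24\<close> times the size of the code, because
  coordinates are pairwise uncorrelated; the weights 0, 24 and 8, 16 contribute 576 and 64 per word.
\<close>

lemma card_octads: "card {c \<in> golay_code. card c = 8} \<ge> 759"
proof -
  let ?e = "\<lambda>i c. 1 - 2 * of_bool (i \<in> c) :: int"
  let ?A = "\<lambda>w. {c \<in> golay_code. card c = w}"
  have "(\<Sum>c\<in>golay_code. (24 - 2 * int (card c))\<^sup>2) = (\<Sum>c\<in>golay_code. (\<Sum>i\<in>UNIV. ?e i c) * (\<Sum>j\<in>UNIV. ?e j c))"
    by (simp add: sum_subtractf sum_of_bool_mem power2_eq_square flip: sum_distrib_left)
  also have "\<dots> = (\<Sum>c\<in>golay_code. \<Sum>i\<in>UNIV. \<Sum>j\<in>UNIV. ?e i c * ?e j c)"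
    by (simp only: sum_product)
  also have "\<dots> = (\<Sum>i\<in>UNIV. \<Sum>c\<in>golay_code. \<Sum>j\<in>UNIV. ?e i c * ?e j c)"
    by (rule sum.swap)
  also have "\<dots> = (\<Sum>i\<in>UNIV. \<Sum>j\<in>UNIV. \<Sum>c\<in>golay_code. ?e i c * ?e j c)"
    by (rule sum.cong[OF refl]) (rule sum.swap)
  also have "\<dots> = (\<Sum>i\<in>(UNIV :: 23 option set). \<Sum>j\<in>UNIV. if j = i then int (card golay_code) else 0)"
  proof (intro sum.cong refl)
    fix i j :: "23 option"
    show "(\<Sum>c\<in>golay_code. ?e i c * ?e j c) = (if j = i then int (card golay_code) else 0)"
    proof (cases "j = i")
      case True
      have "?e i c * ?e i c = 1" for c
        by simp
      then show ?thesis
        using True by simp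
    qed (use sum_sign_products_eq_0 in auto)
  qed
  also have "\<dots> = 24 * int (card golay_code)"
    by simp
  finally have "(\<Sum>c\<in>golay_code. (24 - 2 * int (card c))\<^sup>2) = 24 * int (card golay_code)" .
  moreover have "(\<Sum>c\<in>golay_code. (24 - 2 * int (card c))\<^sup>2) =
      (\<Sum>c\<in>golay_code. 576 * of_bool (card c = 0) + 576 * of_bool (card c = 24)
        + 64 * of_bool (card c = 8) + 64 * of_bool (card c = 16))"
  proof (rule sum.cong)
    fix c assume "c \<in> golay_code"
    from card_golay[OF this] show "(24 - 2 * int (card c))\<^sup>2 = 576 * of_bool (card c = 0)
        + 576 * of_bool (card c = 24) + 64 * of_bool (card c = 8) + 64 * of_bool (card c = 16)"
      by (elim insertE emptyE) simp_all
  qed simp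
  moreover have "(\<Sum>c\<in>golay_code. 576 * of_bool (card c = 0) + 576 * of_bool (card c = 24)
        + 64 * of_bool (card c = 8) + 64 * of_bool (card c = 16)) =
      576 * int (card (?A 0)) + 576 * int (card (?A 24)) + 64 * int (card (?A 8)) + 64 * int (card (?A 16))"
  proof -
    have "(\<Sum>c\<in>golay_code. k * of_bool (card c = w)) = k * int (card (?A w))" for k :: int and w
      by (simp add: of_bool_def sum.If_cases Int_def flip: sum_distrib_left)
    then show ?thesis
      by (simp only: sum.distrib)
  qed
  moreover have "card (?A 0) \<le> 1"
    using card_mono[of "{{}}" "?A 0"] by auto
  moreover have card_Compl: "card (- c) = 24 - card c" for c :: "23 option set"
    by (simp add: Compl_eq_Diff_UNIV card_Diff_subset)
  have "bij_betw uminus (?A w) (?A (24 - w))" if "w \<le> 24" for w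
    by (rule bij_betw_byWitness[of _ uminus])
      (use that in \<open>auto simp: Compl_mem_golay card_Compl\<close>)
  then have "card (?A w) = card (?A (24 - w))" if "w \<le> 24" for w
    using bij_betw_same_card that by blast
  from this[of 0] this[of 8] have "card (?A 24) = card (?A 0)" "card (?A 16) = card (?A 8)"
    by simp_all
  \<comment> \<open>Weight 12 contributes nothing, and (24 * 4096 - 1152) / 128 = 759.\<close>
  ultimately have "24 * int (card golay_code) \<le> 1152 + 128 * int (card (?A 8))"
    by linarith
  then show ?thesis
    using card_golay_code_ge by linarith
qed

section \<open>The Leech lattice\<close>

definition leech_int :: "(23 option \<Rightarrow> int) set" where
  "leech_int = {a. \<exists>m. (\<forall>i. a i mod 2 = m mod 2) \<and> (\<Sum>i\<in>UNIV. a i) mod 8 = (4 * m) mod 8 \<and>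
     (\<forall>k. {i. a i mod 4 = k mod 4} \<in> golay_code)}"

text \<open>As 24m and 2|c| are divisible by 8, the condition on the coordinate sum says that sum d
  and m have equal parity. In this normal form, sums and products of lattice vectors can be expanded
  termwise.\<close>

lemma leech_intI:
  assumes c: "c \<in> golay_code" and a: "\<And>i. a i = m + 2 * of_bool (i \<in> c) + 4 * d i"
    and d: "even (sum d UNIV - m)"
  shows "a \<in> leech_int"
proof -
  obtain k where k: "card c = 4 * k"
    using dvd_card_golay[OF c] by blast
  have "sum a UNIV = 24 * m + 2 * int (card c) + 4 * sum d UNIV"
    by (simp add: a sum.distrib sum_of_bool_mem flip: sum_distrib_left)
  moreover obtain u where "sum d UNIV - m = 2 * u"
    using d by (rule evenE)
  ultimately have "sum a UNIV = 4 * m + (3 * m + int k + u) * 8"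
    by (simp add: k)
  then have "sum a UNIV mod 8 = (4 * m) mod 8"
    by (simp only: mod_mult_self1)
  moreover have "{i. a i mod 4 = k mod 4} \<in> golay_code" for k
  proof -
    have "x mod 4 = 2 \<or> x mod 4 = 0 \<or> odd x" for x :: int
      by presburger
    from this[of "k - m"] consider "(k - m) mod 4 = 2" | "(k - m) mod 4 = 0" | "odd (k - m)"
      by blast
    then show ?thesis
    proof cases
      case 1
      have "(a i mod 4 = k mod 4) = (i \<in> c)" for i
        using 1 unfolding a by (cases "i \<in> c"; simp; presburger)
      then show ?thesis using c by simp
    next
      case 2
      have "(a i mod 4 = k mod 4) = (i \<in> - c)" for i
        using 2 unfolding a by (cases "i \<in> c"; simp; presburger)
      then show ?thesis using Compl_mem_golay[OF c] by (simp add: Compl_eq)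
    next
      case 3
      have "(a i mod 4 = k mod 4) = False" for i
        using 3 unfolding a by (cases "i \<in> c"; simp; presburger)
      then show ?thesis using golay_code.zero by simp
    qed
  qed
  moreover have "a i mod 2 = m mod 2" for i
    unfolding a by (cases "i \<in> c"; simp; presburger)
  ultimately show ?thesis
    unfolding leech_int_def by blast
qed

lemma leech_intE:
  assumes "a \<in> leech_int"
  obtains c m d where "c \<in> golay_code" "\<forall>i. a i = m + 2 * of_bool (i \<in> c) + 4 * d i" "even (sum d UNIV - m)"
proof -
  obtain m where m: "\<And>i. a i mod 2 = m mod 2" "sum a UNIV mod 8 = (4 * m) mod 8"
      "\<And>k. {i. a i mod 4 = k mod 4} \<in> golay_code"
    using assms unfolding leech_int_def by blast
  define c where "c = {i. a i mod 4 = (m + 2) mod 4}"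
  have c: "c \<in> golay_code"
    unfolding c_def by (rule m(3))
  define d where "d i = (a i - m - 2 * of_bool (i \<in> c)) div 4" for i
  have a: "a i = m + 2 * of_bool (i \<in> c) + 4 * d i" for i
  proof -
    obtain q where "a i - m = 2 * q"
      using m(1)[of i] unfolding mod_eq_dvd_iff by (rule dvdE)
    then have q: "a i = m + 2 * q"
      by simp
    have "i \<in> c \<longleftrightarrow> odd q"
      by (simp add: c_def mod_eq_dvd_iff q) presburger
    then have "2 * q = 2 * of_bool (i \<in> c) + 4 * (q div 2)"
      by (cases "odd q") (auto elim!: oddE)
    then show ?thesis
      by (simp add: d_def q)
  qed
  obtain k where k: "card c = 4 * k"
    using dvd_card_golay[OF c] by blast
  have "sum a UNIV = 24 * m + 2 * int (card c) + 4 * sum d UNIV"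
    by (simp add: a sum.distrib sum_of_bool_mem flip: sum_distrib_left)
  moreover obtain q where "sum a UNIV - 4 * m = 8 * q"
    using m(2) unfolding mod_eq_dvd_iff by (rule dvdE)
  ultimately have "sum d UNIV - m = 2 * (q - 3 * m - int k)"
    by (simp add: k)
  then have "even (sum d UNIV - m)"
    by (simp only: dvd_triv_left)
  with c a show ?thesis
    using that by blast
qed

lemma zero_mem_leech_int: "(\<lambda>_. 0) \<in> leech_int"
  by (rule leech_intI[of "{}" _ 0 "\<lambda>_. 0"]) (auto intro: golay_code.zero)

lemma diff_mem_leech_int:
  assumes "a \<in> leech_int" "b \<in> leech_int"
  shows "(\<lambda>i. a i - b i) \<in> leech_int"
proof -
  obtain c m d where a: "c \<in> golay_code" "\<forall>i. a i = m + 2 * of_bool (i \<in> c) + 4 * d i" "even (sum d UNIV - m)"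
    using assms(1) by (rule leech_intE)
  obtain c' m' d' where b: "c' \<in> golay_code" "\<forall>i. b i = m' + 2 * of_bool (i \<in> c') + 4 * d' i" "even (sum d' UNIV - m')"
    using assms(2) by (rule leech_intE)
  show ?thesis
  proof (rule leech_intI)
    show "sym_diff c c' \<in> golay_code"
      using a(1) b(1) by (rule sym_diff_mem_golay)
    \<comment> \<open>The difference of two indicators is that of the symmetric difference minus
      twice that of c' - c; this carry moves into the multiples of 4.\<close>
    show "a i - b i = (m - m') + 2 * of_bool (i \<in> sym_diff c c') + 4 * (d i - d' i - of_bool (i \<in> c' - c))" for i
      by (auto simp: a(2) b(2))
    have "card c' = card (c' - c) + card (c' \<inter> c)"
      by (simp add: card_Diff_subset_Int card_mono)
    moreover have "even (card c')"
      using dvd_card_golay[OF b(1)] by (metis dvd_trans even_numeral)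
    moreover have "even (card (c' \<inter> c))"
      using even_card_Int_golay[OF b(1) a(1)] .
    ultimately have "even (card (c' - c))"
      by simp
    then show "even ((\<Sum>i\<in>UNIV. d i - d' i - of_bool (i \<in> c' - c)) - (m - m'))"
      using a(3) b(3) by (simp add: sum_subtractf sum_of_bool_mem del: Diff_iff)
  qed
qed

lemma minus_mem_leech_int: "a \<in> leech_int \<Longrightarrow> (\<lambda>i. - a i) \<in> leech_int"
  using diff_mem_leech_int[OF zero_mem_leech_int] by simp

text \<open>Weights are divisible by 4, intersections are even, and the parity conditions make 4m
  sum d' + 4m' sum d a multiple of 8. After scaling, inner products are integers.\<close>

lemma leech_int_inner:
  assumes "a \<in> leech_int" "b \<in> leech_int"
  shows "8 dvd (\<Sum>i\<in>UNIV. a i * b i)"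
proof -
  obtain c m d where a: "c \<in> golay_code" "\<forall>i. a i = m + 2 * of_bool (i \<in> c) + 4 * d i" "even (sum d UNIV - m)"
    using assms(1) by (rule leech_intE)
  obtain c' m' d' where b: "c' \<in> golay_code" "\<forall>i. b i = m' + 2 * of_bool (i \<in> c') + 4 * d' i" "even (sum d' UNIV - m')"
    using assms(2) by (rule leech_intE)
  define r where "r i = of_bool (i \<in> c) * d' i + d i * of_bool (i \<in> c') + 2 * d i * d' i" for i
  have "a i * b i = m * m' + 2 * m * of_bool (i \<in> c') + 2 * m' * of_bool (i \<in> c)
      + 4 * of_bool (i \<in> c \<inter> c') + 4 * m * d' i + 4 * m' * d i + 8 * r i" for i
    unfolding a(2)[rule_format] b(2)[rule_format] r_def by (cases "i \<in> c"; cases "i \<in> c'") (simp_all add: algebra_simps)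
  then have "(\<Sum>i\<in>UNIV. a i * b i) = 24 * (m * m') + 2 * m * int (card c') + 2 * m' * int (card c)
      + 4 * int (card (c \<inter> c')) + 4 * m * sum d' UNIV + 4 * m' * sum d UNIV + 8 * sum r UNIV"
    by (simp only: sum.distrib sum_of_bool_mem flip: sum_distrib_left) simp
  moreover obtain k where "card c = 4 * k"
    using dvd_card_golay[OF a(1)] by blast
  moreover obtain k' where "card c' = 4 * k'"
    using dvd_card_golay[OF b(1)] by blast
  moreover obtain l where "card (c \<inter> c') = 2 * l"
    using even_card_Int_golay[OF a(1) b(1)] by blast
  moreover obtain u where "sum d UNIV = m + 2 * u"
    using a(3) by (metis add.commute diff_add_cancel evenE)
  moreover obtain u' where "sum d' UNIV = m' + 2 * u'"
    using b(3) by (metis add.commute diff_add_cancel evenE)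
  ultimately have "(\<Sum>i\<in>UNIV. a i * b i) =
      8 * (4 * (m * m') + m * int k' + m' * int k + int l + m * u' + m' * u + sum r UNIV)"
    by (simp add: algebra_simps)
  then show ?thesis
    by simp
qed

text \<open>The scaled lattice is even: 24 m^2 + 8m sum d is congruent to 32 m^2 modulo 16, since
  sum d and m have equal parity.\<close>

lemma leech_int_norm_dvd:
  assumes "a \<in> leech_int"
  shows "16 dvd (\<Sum>i\<in>UNIV. (a i)\<^sup>2)"
proof -
  obtain c m d where a: "c \<in> golay_code" "\<forall>i. a i = m + 2 * of_bool (i \<in> c) + 4 * d i" "even (sum d UNIV - m)"
    using assms by (rule leech_intE)
  define r where "r i = of_bool (i \<in> c) * d i + (d i)\<^sup>2" for i
  have "(a i)\<^sup>2 = m * m + 4 * (m + 1) * of_bool (i \<in> c) + 8 * m * d i + 16 * r i" for i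
    unfolding a(2)[rule_format] r_def by (simp add: algebra_simps power2_eq_square)
  then have "(\<Sum>i\<in>UNIV. (a i)\<^sup>2) = 24 * (m * m) + 4 * (m + 1) * int (card c) + 8 * m * sum d UNIV + 16 * sum r UNIV"
    by (simp only: sum.distrib sum_of_bool_mem flip: sum_distrib_left) simp
  moreover obtain k where "card c = 4 * k"
    using dvd_card_golay[OF a(1)] by blast
  moreover obtain u where "sum d UNIV = m + 2 * u"
    using a(3) by (metis add.commute diff_add_cancel evenE)
  ultimately have "(\<Sum>i\<in>UNIV. (a i)\<^sup>2) = 16 * (2 * (m * m) + (m + 1) * int k + m * u + sum r UNIV)"
    by (simp add: algebra_simps)
  then show ?thesis
    by simp
qed

text \<open>Squared norm 16 does not occur. An odd vector reaches 24, hence 32 by divisibility; an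
  even one with an entry 2 modulo 4 has at least 8 of them; a vector 4e has even sum e, which
  excludes a single entry 1 or -1 in e.\<close>

lemma leech_int_norm_ge:
  assumes "a \<in> leech_int" "a \<noteq> (\<lambda>_. 0)"
  shows "(\<Sum>i\<in>UNIV. (a i)\<^sup>2) \<ge> 32"
proof -
  obtain m where m: "\<And>i. a i mod 2 = m mod 2" "sum a UNIV mod 8 = (4 * m) mod 8"
      "\<And>k. {i. a i mod 4 = k mod 4} \<in> golay_code"
    using assms unfolding leech_int_def by blast
  show ?thesis
  proof (cases "even m")
    case False
    have "1 \<le> (a i)\<^sup>2" for i
    proof -
      have "a i \<noteq> 0"
        using m(1)[of i] False by presburger
      then show ?thesis
        by (simp add: int_one_le_iff_zero_less)
    qed
    then have "(\<Sum>i\<in>(UNIV :: 23 option set). 1) \<le> (\<Sum>i\<in>UNIV. (a i)\<^sup>2)"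
      by (intro sum_mono) auto
    then show ?thesis
      using leech_int_norm_dvd[OF assms(1)] by simp presburger
  next
    case True
    define c where "c = {i. a i mod 4 = 2}"
    have c: "c \<in> golay_code"
      using m(3)[of 2] by (simp add: c_def)
    show ?thesis
    proof (cases "c = {}")
      case False
      then have "card c \<noteq> 0"
        by simp
      then have "8 \<le> card c"
        using card_golay[OF c] by auto
      have "4 * of_bool (i \<in> c) \<le> (a i)\<^sup>2" for i
      proof (cases "i \<in> c")
        case True
        then have "2 \<le> \<bar>a i\<bar>"
          unfolding c_def by simp presburger
        then have "2\<^sup>2 \<le> \<bar>a i\<bar>\<^sup>2"
          by (intro power_mono) auto
        then show ?thesis
          using True by simp
      qed simp
      then have "(\<Sum>i\<in>UNIV. 4 * of_bool (i \<in> c)) \<le> (\<Sum>i\<in>UNIV. (a i)\<^sup>2)"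
        by (intro sum_mono) auto
      then show ?thesis
        using \<open>8 \<le> card c\<close> by (simp add: sum_of_bool_mem flip: sum_distrib_left)
    next
      case False': True
      have dvd: "4 dvd a i" for i
      proof -
        have "a i mod 4 \<noteq> 2"
          using False' unfolding c_def by blast
        then show ?thesis
          using m(1)[of i] True by presburger
      qed
      define e where "e i = a i div 4" for i
      have e: "a i = 4 * e i" for i
        using dvd[of i] by (simp add: e_def)
      have "sum a UNIV = 4 * sum e UNIV"
        by (simp add: e sum_distrib_left)
      moreover obtain q where "sum a UNIV - 4 * m = 8 * q"
        using m(2) unfolding mod_eq_dvd_iff by (rule dvdE)
      ultimately have "sum e UNIV = m + 2 * q"
        by simp
      then have "even (sum e UNIV)"
        using True by simp
      moreover have "even (\<Sum>i\<in>UNIV. (e i)\<^sup>2 - e i)"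
        by (intro dvd_sum) simp
      ultimately have "even (\<Sum>i\<in>UNIV. (e i)\<^sup>2)"
        by (simp add: sum_subtractf)
      moreover obtain i where "e i \<noteq> 0"
        using assms(2) e by fastforce
      then have "0 < (\<Sum>i\<in>UNIV. (e i)\<^sup>2)"
        by (intro sum_pos2[of _ i]) auto
      ultimately have "2 \<le> (\<Sum>i\<in>UNIV. (e i)\<^sup>2)"
        by presburger
      then show ?thesis
        by (simp add: e power_mult_distrib flip: sum_distrib_left)
    qed
  qed
qed

section \<open>Counting the short vectors\<close>

lemma card_even_subsets:
  assumes "finite S" "S \<noteq> {}"
  shows "2 * card {s. s \<subseteq> S \<and> even (card s)} = 2 ^ card S"
proof -
  have "card {s. s \<subseteq> S \<and> even (card s)} = card {s. s \<subseteq> S \<and> odd (card s)}"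
    using card_subsupersets_even_odd[of S "{}"] assms by auto
  moreover have "Pow S = {s. s \<subseteq> S \<and> even (card s)} \<union> {s. s \<subseteq> S \<and> odd (card s)}"
    by auto
  then have "card (Pow S) = card {s. s \<subseteq> S \<and> even (card s)} + card {s. s \<subseteq> S \<and> odd (card s)}"
    using assms(1) by (simp only:) (rule card_Un_disjoint, auto)
  ultimately show ?thesis
    using assms by (simp add: card_Pow)
qed

definition signed_indicator :: "'n set \<Rightarrow> 'n set \<Rightarrow> 'n \<Rightarrow> int" where
  "signed_indicator P s i = of_bool (i \<in> P) - 2 * of_bool (i \<in> s)"

lemma signed_indicator_eq_0_iff: "s \<subseteq> P \<Longrightarrow> signed_indicator P s i = 0 \<longleftrightarrow> i \<notin> P"
  by (auto simp: signed_indicator_def)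

lemma signed_indicator_neg_iff: "s \<subseteq> P \<Longrightarrow> signed_indicator P s i < 0 \<longleftrightarrow> i \<in> s"
  by (auto simp: signed_indicator_def)

lemma signed_indicator_square:
  "s \<subseteq> P \<Longrightarrow> (\<Sum>i\<in>UNIV. (signed_indicator P s i)\<^sup>2) = int (card P)" for P :: "'n::finite set"
  unfolding sum_of_bool_mem[symmetric] by (rule sum.cong) (auto simp: signed_indicator_def)

lemma inj_on_signed_indicator:
  assumes "k > 0"
  shows "inj_on (\<lambda>(P, s) i. k * signed_indicator P s i) {(P, s). s \<subseteq> P}"
proof (rule inj_onI, clarify)
  fix P s P' s'
  assume sub: "s \<subseteq> P" "s' \<subseteq> P'" and eq: "(\<lambda>i. k * signed_indicator P s i) = (\<lambda>i. k * signed_indicator P' s' i)"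
  have "signed_indicator P s i = signed_indicator P' s' i" for i
    using fun_cong[OF eq, of i] assms by simp
  then show "P = P' \<and> s = s'"
    using signed_indicator_eq_0_iff[OF sub(1)] signed_indicator_eq_0_iff[OF sub(2)]
      signed_indicator_neg_iff[OF sub(1)] signed_indicator_neg_iff[OF sub(2)] by (metis set_eqI)
qed

definition short_vectors :: "(23 option \<Rightarrow> int) set" where
  "short_vectors = {a \<in> leech_int. (\<Sum>i\<in>UNIV. (a i)\<^sup>2) = 32}"

lemma finite_short_vectors: "finite short_vectors"
proof (rule finite_subset)
  show "short_vectors \<subseteq> PiE UNIV (\<lambda>_. {-32..32})"
  proof
    fix a assume "a \<in> short_vectors"
    then have a: "(\<Sum>i\<in>UNIV. (a i)\<^sup>2) = 32"
      by (simp add: short_vectors_def)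
    have "\<bar>a i\<bar> \<le> 32" for i
    proof -
      have "\<bar>a i\<bar> \<le> (a i)\<^sup>2"
        using self_le_power[of "\<bar>a i\<bar>" 2] by (cases "a i = 0") auto
      also have "\<dots> \<le> 32"
        unfolding a[symmetric] by (rule member_le_sum) auto
      finally show ?thesis .
    qed
    then have "a i \<in> {-32..32}" for i
      by (simp add: abs_le_iff) (metis abs_le_D2 minus_le_iff)
    then show "a \<in> PiE UNIV (\<lambda>_. {-32..32})"
      by auto
  qed
  show "finite (PiE (UNIV :: 23 option set) (\<lambda>_. {-32..32::int}))"
    by (rule finite_PiE) auto
qed

text \<open>
  The three families below are the vectors of shapes \<open>(\<plusminus>2\<^sup>8, 0\<^sup>1\<^sup>6)\<close>, \<open>(\<plusminus>4\<^sup>2, 0\<^sup>2\<^sup>2)\<close> and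
  \<open>(\<plusminus>3, \<plusminus>1\<^sup>2\<^sup>3)\<close>. Equality follows later from the linear programming bound.
\<close>

lemma card_short_vectors: "card short_vectors \<ge> 196560"
proof -
  define octads where "octads = {c \<in> golay_code. card c = 8}"
  define A' where "A' = Sigma octads (\<lambda>c. {s. s \<subseteq> c \<and> even (card s)})"
  define C' where "C' = Sigma {P :: 23 option set. card P = 2} Pow"
  define B' where "B' = golay_code \<times> (UNIV :: 23 option set)"
  define A where "A = (\<lambda>(P, s) i. 2 * signed_indicator P s i) ` A'"
  define C where "C = (\<lambda>(P, s) i. 4 * signed_indicator P s i) ` C'"
  \<comment> \<open>The vector with -3 at \<open>j\<close> and 1 elsewhere, with signs changed on
    \<open>c\<close>.\<close>
  define g where "g c j i = (1 - 2 * of_bool (i \<in> c)) * (1 - 4 * of_bool (i = j) :: int)" for c j and i :: "23 option"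
  define B where "B = (\<lambda>(c, j). g c j) ` B'"
  have "card A = card A'"
    unfolding A_def by (rule card_image, rule inj_on_subset[OF inj_on_signed_indicator]) (auto simp: A'_def)
  moreover have "card A' = (\<Sum>c\<in>octads. 128)"
    unfolding A'_def
  proof (subst card_SigmaI)
    show "(\<Sum>c\<in>octads. card {s. s \<subseteq> c \<and> even (card s)}) = (\<Sum>c\<in>octads. 128)"
    proof (rule sum.cong)
      fix c assume "c \<in> octads"
      then show "card {s. s \<subseteq> c \<and> even (card s)} = 128"
        using card_even_subsets[of c] by (cases "c = {}") (auto simp: octads_def)
    qed simp
  qed auto
  ultimately have cardA: "card A \<ge> 97152"
    using card_octads by (simp add: octads_def)
  have "card C = card C'"
    unfolding C_def by (rule card_image, rule inj_on_subset[OF inj_on_signed_indicator]) (auto simp: C'_def)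
  also have "\<dots> = (\<Sum>P\<in>{P :: 23 option set. card P = 2}. 4)"
    unfolding C'_def
  proof (subst card_SigmaI)
    show "(\<Sum>P\<in>{P :: 23 option set. card P = 2}. card (Pow P)) = (\<Sum>P\<in>{P :: 23 option set. card P = 2}. 4)"
      by (rule sum.cong) (auto simp: card_Pow)
  qed auto
  also have "\<dots> = 1104"
    using n_subsets[of "UNIV :: 23 option set" 2] by (simp add: choose_two)
  finally have cardC: "card C = 1104" .
  have "inj_on (\<lambda>(c, j). g c j) B'"
  proof (rule inj_onI, clarify)
    fix c j c' j'
    assume eq: "g c j = g c' j'"
    \<comment> \<open>The entry of absolute value 3 recovers \<open>j\<close>, and the class of 3
      modulo 4 recovers \<open>c\<close>.\<close>
    have "{i. \<bar>g c j i\<bar> = 3} = {j}" "{i. g c j i mod 4 = 3} = c" for c j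
      by (auto simp: g_def of_bool_def split: if_splits)
    then show "c = c' \<and> j = j'"
      using eq by (metis singleton_inject)
  qed
  then have "card B = card B'"
    unfolding B_def by (rule card_image)
  then have cardB: "card B \<ge> 98304"
    using card_golay_code_ge by (simp add: B'_def card_cartesian_product)
  have "A \<inter> C = {}"
  proof -
    have "\<bar>a i\<bar> < 4" if "a \<in> A" for a i
      using that by (auto simp: A_def A'_def signed_indicator_def of_bool_def)
    then have "\<not> (\<exists>i. \<bar>a i\<bar> = 4)" if "a \<in> A" for a
      using that by (metis less_irrefl)
    moreover have "\<exists>i. \<bar>a i\<bar> = 4" if C: "a \<in> C" for a
    proof -
      obtain P s where "(P, s) \<in> C'" and a: "a = (\<lambda>i. 4 * signed_indicator P s i)"
        using C by (auto simp: C_def)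
      then have "card P = 2" "s \<subseteq> P"
        by (auto simp: C'_def)
      then have "P \<noteq> {}"
        by auto
      then obtain i where "i \<in> P" by blast
      then have "\<bar>a i\<bar> = 4"
        by (auto simp: a signed_indicator_def)
      then show ?thesis ..
    qed
    ultimately show ?thesis
      by blast
  qed
  moreover have "(A \<union> C) \<inter> B = {}"
  proof -
    have "even (a i)" if "a \<in> A \<union> C" for a i
      using that by (auto simp: A_def C_def)
    moreover have "odd (a i)" if "a \<in> B" for a i
      using that by (auto simp: B_def g_def of_bool_def)
    ultimately show ?thesis
      by blast
  qed
  moreover have fin: "finite A" "finite B" "finite C"
    using cardA cardB cardC by (auto intro: card_ge_0_finite)
  ultimately have "card (A \<union> C \<union> B) = card A + card C + card B"
    by (simp add: card_Un_disjoint)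
  \<comment> \<open>The three counts are 759 * 128, 4 times 24 choose 2, and 24 * 4096.\<close>
  also have "\<dots> \<ge> 196560"
    using cardA cardB cardC by simp
  finally have "196560 \<le> card (A \<union> C \<union> B)" .
  also have "card (A \<union> C \<union> B) \<le> card short_vectors"
  proof (intro card_mono finite_short_vectors Un_least subsetI)
    fix a assume "a \<in> A"
    then obtain P s where a: "P \<in> golay_code" "card P = 8" "s \<subseteq> P" "even (card s)" "a = (\<lambda>i. 2 * signed_indicator P s i)"
      by (auto simp: A_def A'_def octads_def)
    have "a \<in> leech_int"
      using a(1)
    proof (rule leech_intI)
      \<comment> \<open>The minus signs become the multiples of 4, so the lattice condition is that
        their number is even.\<close>
      show "a i = 0 + 2 * of_bool (i \<in> P) + 4 * (- of_bool (i \<in> s))" for i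
        by (simp add: a signed_indicator_def)
      show "even ((\<Sum>i\<in>UNIV. - of_bool (i \<in> s)) - (0 :: int))"
        using a(4) by (simp add: sum_negf sum_of_bool_mem)
    qed
    then show "a \<in> short_vectors"
      using signed_indicator_square[OF a(3)] a(2)
      by (simp add: short_vectors_def a(5) power_mult_distrib flip: sum_distrib_left)
  next
    fix a assume "a \<in> C"
    then obtain P s where a: "card P = 2" "s \<subseteq> P" "a = (\<lambda>i. 4 * signed_indicator P s i)"
      by (auto simp: C_def C'_def)
    have "a \<in> leech_int"
      using golay_code.zero
    proof (rule leech_intI)
      show "a i = 0 + 2 * of_bool (i \<in> {}) + 4 * signed_indicator P s i" for i
        by (simp add: a)
      show "even ((\<Sum>i\<in>UNIV. signed_indicator P s i) - 0)"
        using a(1) by (simp add: signed_indicator_def sum_subtractf sum_of_bool_mem flip: sum_distrib_left)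
    qed
    then show "a \<in> short_vectors"
      using signed_indicator_square[OF a(2)] a(1)
      by (simp add: short_vectors_def a(3) power_mult_distrib flip: sum_distrib_left)
  next
    fix a assume "a \<in> B"
    then obtain c j where a: "c \<in> golay_code" "a = g c j"
      by (auto simp: B_def B'_def)
    have "a \<in> leech_int"
      using a(1)
    proof (rule leech_intI)
      show "a i = 1 + 2 * of_bool (i \<in> c) + 4 * (- of_bool (i \<in> c) - of_bool (i = j) * (1 - 2 * of_bool (j \<in> c)))" for i
        by (auto simp: a g_def)
      have "even (card c)"
        using dvd_card_golay[OF a(1)] by (metis dvd_trans even_numeral)
      moreover have "(\<Sum>i\<in>UNIV. of_bool (i = j) * (1 - 2 * of_bool (j \<in> c))) = (1 - 2 * of_bool (j \<in> c) :: int)"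
        by (simp add: of_bool_def sum.If_cases flip: sum_distrib_right)
      ultimately show "even ((\<Sum>i\<in>UNIV. - of_bool (i \<in> c) - of_bool (i = j) * (1 - 2 * of_bool (j \<in> c))) - (1 :: int))"
        by (simp add: sum_subtractf sum_negf sum_of_bool_mem)
    qed
    moreover have "(a i)\<^sup>2 = 1 + 8 * of_bool (i \<in> {j})" for i
      by (auto simp: a g_def power_mult_distrib)
    then have "(\<Sum>i\<in>UNIV. (a i)\<^sup>2) = 32"
      by (simp only: sum.distrib sum_of_bool_mem flip: sum_distrib_left) simp
    ultimately show "a \<in> short_vectors"
      by (simp add: short_vectors_def)
  qed
  finally show ?thesis .
qed

section \<open>Passage to unit vectors\<close>

definition embed :: "(23 option \<Rightarrow> int) \<Rightarrow> real ^ 23 option" where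
  "embed a = (1 / sqrt 8) *\<^sub>R (\<chi> i. of_int (a i))"

lemma leech_lattice_eq: "leech_lattice = embed ` leech_int"
  unfolding leech_lattice_def leech_int_def embed_def by blast

lemma embed_inner: "embed a \<bullet> embed b = of_int (\<Sum>i\<in>UNIV. a i * b i) / 8"
proof -
  have "1 / sqrt 8 * (1 / sqrt 8 * t) = t / 8" for t :: real
    by simp
  then show ?thesis
    unfolding embed_def inner_scaleR_left inner_scaleR_right by (simp only: inner_vec_def) simp
qed

lemma inj_embed: "inj embed"
proof (rule injI)
  fix a b assume "embed a = embed b"
  then have "embed a $ i = embed b $ i" for i
    by simp
  then show "a = b"
    by (simp add: embed_def fun_eq_iff)
qed

lemma norm_embed: "norm (embed a) = sqrt (of_int (\<Sum>i\<in>UNIV. (a i)\<^sup>2) / 8)"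
  by (simp add: norm_eq_sqrt_inner embed_inner power2_eq_square)

lemma norm_embed_short: "a \<in> short_vectors \<Longrightarrow> norm (embed a) = 2"
  unfolding norm_embed by (simp add: short_vectors_def del: of_int_sum of_int_power)

lemma norm_embed_ge:
  assumes "a \<in> leech_int" "embed a \<noteq> 0"
  shows "norm (embed a) \<ge> 2"
proof -
  have "embed (\<lambda>_. 0) = 0"
    by (simp add: embed_def vec_eq_iff)
  then have "a \<noteq> (\<lambda>_. 0)"
    using assms(2) by auto
  then have "of_int 32 \<le> (of_int (\<Sum>i\<in>UNIV. (a i)\<^sup>2) :: real)"
    unfolding of_int_le_iff by (rule leech_int_norm_ge[OF assms(1)])
  then have "2\<^sup>2 \<le> (of_int (\<Sum>i\<in>UNIV. (a i)\<^sup>2) / 8 :: real)"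
    by simp
  then show ?thesis
    unfolding norm_embed by (rule real_le_rsqrt)
qed

lemma minimal_vectors_leech: "minimal_vectors leech_lattice = embed ` short_vectors"
proof (intro subset_antisym subsetI)
  fix v assume "v \<in> embed ` short_vectors"
  then obtain a where a: "a \<in> short_vectors" "v = embed a" by blast
  then have "norm v = 2" "a \<in> leech_int"
    using norm_embed_short by (auto simp: short_vectors_def)
  then show "v \<in> minimal_vectors leech_lattice"
    using a norm_embed_ge by (auto simp: minimal_vectors_def leech_lattice_eq)
next
  fix v assume v: "v \<in> minimal_vectors leech_lattice"
  then obtain a where a: "a \<in> leech_int" "v = embed a" "v \<noteq> 0"
    by (auto simp: minimal_vectors_def leech_lattice_eq)
  have "short_vectors \<noteq> {}"
    using card_short_vectors by auto
  then obtain b where b: "b \<in> short_vectors" by blast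
  have "norm (embed b) = 2"
    using b by (rule norm_embed_short)
  moreover from this have "embed b \<noteq> 0"
    by auto
  ultimately have "norm v \<le> 2"
    using v b by (fastforce simp: minimal_vectors_def leech_lattice_eq short_vectors_def)
  then have "norm (embed a) = 2"
    using norm_embed_ge[OF a(1)] a by auto
  then have "(norm (embed a))\<^sup>2 = 4"
    by simp
  then have "of_int (\<Sum>i\<in>UNIV. (a i)\<^sup>2) / 8 = (4 :: real)"
    unfolding power2_norm_eq_inner embed_inner by (simp add: power2_eq_square)
  then have "of_int (\<Sum>i\<in>UNIV. (a i)\<^sup>2) = (of_int 32 :: real)"
    by simp
  then have "(\<Sum>i\<in>UNIV. (a i)\<^sup>2) = 32"
    by (simp only: of_int_eq_iff)
  then show "v \<in> embed ` short_vectors"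
    using a by (auto simp: short_vectors_def)
qed

lemma leech_code_eq: "leech_code = (\<lambda>a. (1/2) *\<^sub>R embed a) ` short_vectors"
  unfolding leech_code_def minimal_vectors_leech image_image
  by (rule image_cong) (simp_all add: norm_embed_short)

lemma finite_leech_code: "finite leech_code"
  unfolding leech_code_eq by (rule finite_imageI[OF finite_short_vectors])

lemma card_leech_code: "card leech_code \<ge> 196560"
proof -
  have "inj_on (\<lambda>a. (1/2) *\<^sub>R embed a) short_vectors"
    using inj_embed by (auto simp: inj_on_def)
  then show ?thesis
    using card_short_vectors by (simp add: leech_code_eq card_image)
qed

lemma norm_leech_code: "x \<in> leech_code \<Longrightarrow> norm x = 1"
  by (auto simp: leech_code_eq norm_embed_short)

lemma minus_mem_leech_code:
  assumes "x \<in> leech_code"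
  shows "- x \<in> leech_code"
proof -
  obtain a where a: "a \<in> short_vectors" "x = (1/2) *\<^sub>R embed a"
    using assms by (auto simp: leech_code_eq)
  have "(\<lambda>i. - a i) \<in> short_vectors"
    using a(1) minus_mem_leech_int by (simp add: short_vectors_def)
  moreover have "- x = (1/2) *\<^sub>R embed (\<lambda>i. - a i)"
    by (simp add: a embed_def vec_eq_iff)
  ultimately show ?thesis
    unfolding leech_code_eq by blast
qed

text \<open>The difference would have squared norm 32 + 32 - 48 = 16, below the minimum. For unit
  vectors this excludes the inner product 3/4.\<close>

lemma short_vectors_inner_ne_24:
  assumes "a \<in> short_vectors" "b \<in> short_vectors"
  shows "(\<Sum>i\<in>UNIV. a i * b i) \<noteq> 24"
proof
  assume "(\<Sum>i\<in>UNIV. a i * b i) = 24"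
  then have "(\<Sum>i\<in>UNIV. (a i - b i)\<^sup>2) = 16"
    using assms by (simp add: short_vectors_def power2_diff sum.distrib sum_subtractf mult.assoc flip: sum_distrib_left)
  moreover have "(\<lambda>i. a i - b i) \<in> leech_int"
    using assms by (simp add: short_vectors_def diff_mem_leech_int)
  moreover have "(\<lambda>i. a i - b i) \<noteq> (\<lambda>_. 0)"
  proof
    assume "(\<lambda>i. a i - b i) = (\<lambda>_. 0)"
    then have "a i - b i = 0" for i
      by (rule fun_cong)
    then show False
      using \<open>(\<Sum>i\<in>UNIV. (a i - b i)\<^sup>2) = 16\<close> by simp
  qed
  ultimately show False
    using leech_int_norm_ge by fastforce
qed

lemma inner_leech_code:
  assumes "x \<in> leech_code" "y \<in> leech_code"
  shows "x \<bullet> y \<in> {1, -1, 1/2, -1/2, 1/4, -1/4, 0}"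
proof -
  obtain a b where ab: "a \<in> short_vectors" "x = (1/2) *\<^sub>R embed a" "b \<in> short_vectors" "y = (1/2) *\<^sub>R embed b"
    using assms by (auto simp: leech_code_eq)
  have mb: "(\<lambda>i. - b i) \<in> short_vectors"
    using ab(3) minus_mem_leech_int by (simp add: short_vectors_def)
  have "8 dvd (\<Sum>i\<in>UNIV. a i * b i)"
    using ab by (intro leech_int_inner) (auto simp: short_vectors_def)
  then obtain k where k: "(\<Sum>i\<in>UNIV. a i * b i) = 8 * k"
    by (rule dvdE)
  have xy: "x \<bullet> y = of_int k / 4"
    unfolding ab inner_scaleR_left inner_scaleR_right embed_inner k by simp
  have "\<bar>x \<bullet> y\<bar> \<le> 1"
    using Cauchy_Schwarz_ineq2[of x y] assms by (simp add: norm_leech_code)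
  then have "\<bar>k\<bar> \<le> 4"
    unfolding xy by simp
  moreover have "k \<noteq> 3"
    using short_vectors_inner_ne_24[OF ab(1,3)] k by auto
  moreover have "k \<noteq> -3"
    using short_vectors_inner_ne_24[OF ab(1) mb] k by (auto simp: sum_negf)
  ultimately have "k \<in> {4, -4, 2, -2, 1, -1, 0}"
    by auto
  then show ?thesis
    unfolding xy by (elim insertE emptyE) simp_all
qed

section \<open>The code from the Leech lattice\<close>

lemma finite_inner_products: "finite C \<Longrightarrow> finite (inner_products C)"
  by (rule finite_subset[of _ "(\<lambda>(x, y). x \<bullet> y) ` (C \<times> C)"]) (auto simp: inner_products_def)

lemma spherical_code_leech_code: "spherical_code leech_code"
  using finite_leech_code norm_leech_code by (auto simp: spherical_code_def)

lemma inner_identifies_complement: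
  assumes "identifies_complement U x"
  shows "U v \<bullet> U w = v \<bullet> w"
proof -
  have lin: "linear U" and norm: "norm (U v) = norm v" for v
    using assms by (auto simp: identifies_complement_def)
  show ?thesis
    unfolding dot_norm linear_add[OF lin, symmetric] norm ..
qed

lemma inj_identifies_complement:
  assumes "identifies_complement U x"
  shows "inj U"
proof (rule injI)
  fix v w assume "U v = U w"
  have lin: "linear U" and norm: "norm (U v) = norm v" for v
    using assms by (auto simp: identifies_complement_def)
  have "norm (v - w) = 0"
    unfolding norm[symmetric] linear_diff[OF lin] using \<open>U v = U w\<close> by simp
  then show "v = w"
    by simp
qed

text \<open>Removing the components along \<open>x\<close> subtracts 1/16 and rescaling divides by
  15/16. So 1/2, 1/4, 0, -1/4, -1/2 become 7/15, 1/5, -1/15, -1/3, -3/5.\<close>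

lemma inner_C_quarter:
  fixes x y z :: "'a::real_inner"
  assumes "norm x = 1" "x \<bullet> y = 1/4" "x \<bullet> z = 1/4"
  shows "((y - (1/4) *\<^sub>R x) /\<^sub>R sqrt (1 - 1/16)) \<bullet> ((z - (1/4) *\<^sub>R x) /\<^sub>R sqrt (1 - 1/16)) = (16 * (y \<bullet> z) - 1) / 15"
proof -
  have "inverse s * (inverse s * t) = t / (s * s)" for s t :: real
    by (cases "s = 0") (simp_all add: field_simps)
  from this[of "sqrt (1 - 1/16)"] have "inverse (sqrt (1 - 1/16)) * (inverse (sqrt (1 - 1/16)) * t) = t / (15/16)" for t :: real
    unfolding real_sqrt_mult_self by simp
  moreover have "(y - (1/4) *\<^sub>R x) \<bullet> (z - (1/4) *\<^sub>R x) = y \<bullet> z - 1/16"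
  proof -
    have "x \<bullet> x = 1"
      using assms(1) by (simp add: norm_eq_1)
    then show ?thesis
      by (simp add: inner_diff_left inner_diff_right inner_commute[of y x] assms(2,3))
  qed
  ultimately show ?thesis
    by (simp only: inner_scaleR_left inner_scaleR_right) simp
qed

lemma C_quarter_facts:
  fixes U :: "real ^ 'n::finite \<Rightarrow> real ^ 23 option"
  assumes n: "CARD('n) = 23" and x: "x \<in> leech_code" and U: "identifies_complement U x"
  shows "spherical_code (U -` C_quarter x)" and "card (U -` C_quarter x) = 47104"
    and "inner_products (U -` C_quarter x) \<subseteq> {-3/5, -1/3, -1/15, 1/5, 7/15}"
    and "7/15 \<in> inner_products (U -` C_quarter x)"
proof -
  define N where "N = {y \<in> leech_code. x \<bullet> y = 1/4}"
  define p where "p y = (y - (1/4) *\<^sub>R x) /\<^sub>R sqrt (1 - 1/16)" for y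
  let ?C = "U -` C_quarter x"
  have C_quarter: "C_quarter x = p ` N"
    unfolding C_quarter_def N_def p_def by blast
  have norm_x: "norm x = 1"
    using x by (rule norm_leech_code)
  have "x \<bullet> p y = 0" if "y \<in> N" for y
    using that norm_x by (simp add: p_def N_def inner_diff_right norm_eq_1)
  then have "p ` N \<subseteq> range U"
    using U by (auto simp: identifies_complement_def)
  \<comment> \<open>The projected points are orthogonal to \<open>x\<close>, so the preimage under
    \<open>U\<close> loses none of them.\<close>
  then have image: "U ` ?C = p ` N"
    unfolding C_quarter by auto
  have inj_U: "inj U"
    using U by (rule inj_identifies_complement)
  have "sqrt (1 - 1/16) \<noteq> (0 :: real)"
    by simp
  then have inj_p: "inj_on p N"
    by (auto simp: inj_on_def p_def)
  have card_N: "card N = 47104"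
    unfolding N_def using spherical_code_leech_code card_leech_code inner_leech_code minus_mem_leech_code x
    by (intro card_neighbours) simp_all
  have "card ?C = card (U ` ?C)"
    using inj_U by (intro card_image[symmetric]) (rule inj_on_subset, auto)
  then show card_C: "card ?C = 47104"
    using card_N by (simp only: image card_image[OF inj_p])
  have inner: "\<exists>y\<in>N. \<exists>z\<in>N. U u = p y \<and> U v = p z \<and> u \<bullet> v = (16 * (y \<bullet> z) - 1) / 15" if uv: "u \<in> ?C" "v \<in> ?C" for u v
  proof -
    obtain y z where yz: "y \<in> N" "z \<in> N" "U u = p y" "U v = p z"
      using uv unfolding vimage_eq C_quarter by blast
    have "u \<bullet> v = p y \<bullet> p z"
      using inner_identifies_complement[OF U, of u v] yz by simp
    also have "\<dots> = (16 * (y \<bullet> z) - 1) / 15"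
      unfolding p_def using yz norm_x by (intro inner_C_quarter) (auto simp: N_def)
    finally show ?thesis
      using yz by blast
  qed
  have "norm u = 1" if u: "u \<in> ?C" for u
  proof -
    obtain y where y: "y \<in> N" "U u = p y"
      using u unfolding vimage_eq C_quarter by blast
    have "norm y = 1"
      using y norm_leech_code by (simp add: N_def)
    have "u \<bullet> u = p y \<bullet> p y"
      using inner_identifies_complement[OF U, of u u] y by simp
    also have "\<dots> = (16 * (y \<bullet> y) - 1) / 15"
      unfolding p_def using y norm_x by (intro inner_C_quarter) (auto simp: N_def)
    finally show ?thesis
      using \<open>norm y = 1\<close> by (simp add: norm_eq_1)
  qed
  moreover have "finite ?C"
    using card_C by (intro card_ge_0_finite) simp
  ultimately show code: "spherical_code ?C"
    by (auto simp: spherical_code_def)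
  have ip: "u \<bullet> v \<in> {-3/5, -1/3, -1/15, 1/5, 7/15}" if uv: "u \<in> ?C" "v \<in> ?C" "u \<noteq> v" for u v
  proof -
    obtain y z where yz: "y \<in> N" "z \<in> N" "U u = p y" "U v = p z" "u \<bullet> v = (16 * (y \<bullet> z) - 1) / 15"
      using inner[OF uv(1,2)] by blast
    then have L: "y \<in> leech_code" "z \<in> leech_code" and norms: "norm y = 1" "norm z = 1"
      and x_inner: "x \<bullet> y = 1/4" "x \<bullet> z = 1/4"
      using norm_leech_code by (auto simp: N_def)
    have "y \<noteq> z"
      using uv(3) yz(3,4) inj_eq[OF inj_U, of u v] by auto
    then have "y \<bullet> z \<noteq> 1"
      using norm_cauchy_schwarz_eq[of y z] norms by auto
    \<comment> \<open>Antipodes cannot both have inner product 1/4 with \<open>x\<close>.\<close>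
    moreover have "y \<bullet> z \<noteq> -1"
    proof
      assume "y \<bullet> z = -1"
      then have "- y = z"
        using norm_cauchy_schwarz_eq[of "- y" z] norms by simp
      then have "x \<bullet> z = - (x \<bullet> y)"
        by auto
      then show False
        using x_inner by simp
    qed
    ultimately have "y \<bullet> z \<in> {1/2, -1/2, 1/4, -1/4, 0}"
      using inner_leech_code[OF L] by blast
    moreover have "(16 * t - 1) / 15 \<in> {-3/5, -1/3, -1/15, 1/5, 7/15}" if "t \<in> {1/2, -1/2, 1/4, -1/4, 0}" for t :: real
      using that by (elim insertE emptyE; hypsubst; simp)
    ultimately show ?thesis
      unfolding yz(5) by blast
  qed
  then show "inner_products ?C \<subseteq> {-3/5, -1/3, -1/15, 1/5, 7/15}"
    unfolding inner_products_def by blast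
  show "7/15 \<in> inner_products ?C"
  proof (rule ccontr)
    assume "7/15 \<notin> inner_products ?C"
    have "u \<bullet> v \<in> {-3/5, -1/3, -1/15, 1/5}" if uv: "u \<in> ?C" "v \<in> ?C" "u \<noteq> v" for u v
    proof -
      have "u \<bullet> v \<in> inner_products ?C"
        using uv unfolding inner_products_def by blast
      with \<open>7/15 \<notin> inner_products ?C\<close> have "u \<bullet> v \<noteq> 7/15"
        by metis
      then show ?thesis
        using ip[OF uv] by blast
    qed
    then have "card ?C < 268"
      by (intro card_lt_if_le_1_5[OF n code])
    then show False
      using card_C by simp
  qed
qed

theorem theorem5p1:
  fixes T :: "real set"
  assumes "T \<in> {{-3/5 <..< -1/3}, {-1/3 <..< -1/15}, {-1/15 <..< 1/5}}"
  shows "max_avoiding TYPE(23) (7/15) T = 47104 \<and>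
    (\<forall>x \<in> leech_code. \<forall>U :: real ^ 23 \<Rightarrow> real ^ 23 option.
       identifies_complement U x \<longrightarrow> maximal_avoiding_code (7/15) T (U -` C_quarter x))"
proof -
  define codes where "codes = {C :: (real ^ 23) set. spherical_code C \<and> avoiding T C \<and>
    (inner_products C \<noteq> {} \<longrightarrow> max_inner_product C \<le> 7/15)}"
  have max_eq: "max_avoiding TYPE(23) (7/15) T = (SUP C\<in>codes. enat (card C))"
    unfolding max_avoiding_def codes_def ..
  have upper: "card C \<le> 47104" if "C \<in> codes" for C
  proof (rule card_le_47104)
    show code: "spherical_code C" and "avoiding T C"
      using that by (auto simp: codes_def)
    fix x y assume "x \<in> C" "y \<in> C" "x \<noteq> y"
    then have "x \<bullet> y \<in> inner_products C"
      unfolding inner_products_def by blast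
    moreover have "finite (inner_products C)"
      using code by (intro finite_inner_products) (simp add: spherical_code_def)
    ultimately have "x \<bullet> y \<le> max_inner_product C" "inner_products C \<noteq> {}"
      unfolding max_inner_product_def by auto
    then show "x \<bullet> y \<le> 7/15"
      using that by (auto simp: codes_def)
  qed (use assms in simp_all)
  have attained: "is_s_code (7/15) (U -` C_quarter x) \<and> avoiding T (U -` C_quarter x) \<and>
      card (U -` C_quarter x) = 47104 \<and> U -` C_quarter x \<in> codes"
    if x: "x \<in> leech_code" and U: "identifies_complement U x" for x and U :: "real ^ 23 \<Rightarrow> real ^ 23 option"
  proof -
    have "CARD(23) = 23"
      by simp
    note facts = C_quarter_facts[OF this x U]
    have "avoiding T (U -` C_quarter x)"
    proof -
      \<comment> \<open>\<open>T\<close> is an open interval between consecutive inner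
        products.\<close>
      have "{-3/5, -1/3, -1/15, 1/5, 7/15} \<inter> T = {}"
        using assms by auto
      then show ?thesis
        using facts(3) unfolding avoiding_def by blast
    qed
    moreover have "max_inner_product (U -` C_quarter x) = 7/15"
      unfolding max_inner_product_def
    proof (rule Max_eqI)
      show "finite (inner_products (U -` C_quarter x))"
        using facts(3) by (rule finite_subset) simp
      show "t \<le> 7/15" if "t \<in> inner_products (U -` C_quarter x)" for t
        using that facts(3) by auto
    qed (rule facts(4))
    ultimately show ?thesis
      using facts by (auto simp: is_s_code_def codes_def)
  qed
  have "leech_code \<noteq> {}"
    using card_leech_code by auto
  then obtain x where x: "x \<in> leech_code"
    by blast
  then have "x \<noteq> 0"
    using norm_leech_code by fastforce
  then obtain U :: "real ^ 23 \<Rightarrow> real ^ 23 option" where "identifies_complement U x"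
    using ex_identifies_complement[of x, where 'n = 23] by auto
  note U = attained[OF x this]
  have "max_avoiding TYPE(23) (7/15) T = enat 47104"
    unfolding max_eq
  proof (rule antisym)
    show "(SUP C\<in>codes. enat (card C)) \<le> enat 47104"
      using upper by (auto intro: SUP_least)
    have "enat (card (U -` C_quarter x)) \<le> (SUP C\<in>codes. enat (card C))"
      using U by (intro SUP_upper) blast
    then show "enat 47104 \<le> (SUP C\<in>codes. enat (card C))"
      using U by simp
  qed
  then show ?thesis
    using attained unfolding maximal_avoiding_code_def by (simp add: numeral_eq_enat)
qed

end
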